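(* Let $\mathcal{E}_1,\mathcal{E}_2$ be Hilbert spaces. Then $T$ belongs to $\mathcal{S}(\mathcal{H},\mathcal{E}_1,\mathcal{E}_2)$ if and only if $T^*$ is the transfer map of a system in $\mathcal{BS}_N(\mathcal{E}_1,\mathcal{E}_2,\mathcal{F})$ for some Hilbert space $\mathcal{F}$.
   Context: Fix an integer $N\ge 1$ and $\mathcal{H}=\mathbb{C}^N$. $\mathcal{H}_k$ ($k\ge 0$) is the Hilbert space $\mathbb{C}^{N^k}$ with orthonormal basis $\{e_\sigma\}$ indexed by the words $\sigma$ of length $k$ on the letters $1,\dots,N$, in lexicographic order; for $k\ge1$, $\mathcal{H}_k$ is identified with the direct sum of $N$ copies of $\mathcal{H}_{k-1}$, the $j$-th copy being spanned by the $e_{j\sigma}$, $|\sigma|=k-1$; correspondingly $\mathcal{H}_k\otimes\mathcal{E}=(\mathcal{H}_{k-1}\otimes\mathcal{E})^{\oplus N}=\mathcal{E}^{\oplus N^k}$ for a Hilbert space $\mathcal{E}$. $R^{\oplus N}$ is the direct sum of $N$ copies of an operator $R$. $\mathcal{S}(\mathcal{H},\mathcal{E}_1,\mathcal{E}_2)$ is the set of contractions $T=[T_{ij}]_{i,j=0}^\infty$ from $\bigoplus_{k=0}^\infty(\mathcal{H}_k\otimes\mathcal{E}_1)$ to $\bigoplus_{k=0}^\infty(\mathcal{H}_k\otimes\mathcal{E}_2)$, with $T_{ij}:\mathcal{H}_j\otimes\mathcal{E}_1\to\mathcal{H}_i\otimes\mathcal{E}_2$, that are upper triangular ($T_{ij}=0$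 for $i>j$) and satisfy $T_{ij}=T_{i-1,j-1}^{\oplus N}$ for $1\le i\le j$. For a Hilbert space $\mathcal{F}$, $\mathcal{BS}_N(\mathcal{E}_1,\mathcal{E}_2,\mathcal{F})$ is the class of systems $\Sigma$: $$x(n+1)=A(n)x(n)+B(n)u(n),\qquad y(n)=C(n)x(n)+D(n)u(n),\qquad n\ge 0,$$ where $A(0)\in\mathcal{L}(\mathcal{F},\mathcal{F}^{\oplus N})$, $B(0)\in\mathcal{L}(\mathcal{E}_2,\mathcal{F}^{\oplus N})$, $C(0)\in\mathcal{L}(\mathcal{F},\mathcal{E}_1)$, $D(0)\in\mathcal{L}(\mathcal{E}_2,\mathcal{E}_1)$; for $n\ge1$, $A(n)=A(n-1)^{\oplus N}$, $B(n)=B(n-1)^{\oplus N}$, $C(n)=C(n-1)^{\oplus N}$, $D(n)=D(n-1)^{\oplus N}$; and for all $n\ge 0$ the operator $\begin{bmatrix}A(n)&B(n)\\C(n)&D(n)\end{bmatrix}$ is a coisometry. The transfer map $T_\Sigma$ of $\Sigma$ is the operator sending the input sequence $(u(0),u(1),\dots)$ to the output sequence $(y(0),y(1),\dots)$ when $x(0)=0$; it is the lower triangular contraction with block entries $T_\Sigma(n,n)=D(n)$, $T_\Sigma(n+1,n)=C(n+1)B(n)$, and $T_\Sigma(n+j,n)=C(n+j)A(n+j-1)\cdots A(n+1)B(n)$ for $j>1$. *)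

theory Defs
  imports "HOL-Analysis.Analysis"
begin

section \<open>Complex Hilbert spaces\<close>

text \<open>The inner product \<open>cinner\<close> is linear in its first argument. The norm, the topology and
  the completeness are those of the underlying real Hilbert space, whose inner product is the real
  part of \<open>cinner\<close>; hence \<open>cinner x x\<close> is the square of the norm of \<open>x\<close>.\<close>

class complex_hilbert = real_inner + complete_space +
  fixes scaleC :: "complex \<Rightarrow> 'a \<Rightarrow> 'a"
    and cinner :: "'a \<Rightarrow> 'a \<Rightarrow> complex"
  assumes scaleC_add_right: "scaleC c (x + y) = scaleC c x + scaleC c y"
    and scaleC_add_left: "scaleC (c + d) x = scaleC c x + scaleC d x"
    and scaleC_scaleC: "scaleC c (scaleC d x) = scaleC (c * d) x"
    and scaleR_scaleC: "scaleR r x = scaleC (of_real r) x"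
    and cinner_commute: "cinner x y = cnj (cinner y x)"
    and cinner_add_left: "cinner (x + y) z = cinner x z + cinner y z"
    and cinner_scaleC_left: "cinner (scaleC c x) y = c * cinner x y"
    and inner_eq_Re_cinner: "inner x y = Re (cinner x y)"

lemma cinner_self: "cinner x x = of_real ((norm x)\<^sup>2)" for x :: "'a::complex_hilbert"
proof -
  have "Im (cinner x x) = 0"
    using arg_cong[OF cinner_commute[of x x], of Im] by simp
  then show ?thesis
    by (simp add: complex_eq_iff power2_norm_eq_inner inner_eq_Re_cinner)
qed

lemma norm_scaleC: "norm (scaleC c x) = cmod c * norm x" for x :: "'a::complex_hilbert"
proof -
  have "cinner (scaleC c x) (scaleC c x) = c * cnj c * cinner x x"
    by (metis cinner_scaleC_left cinner_commute complex_cnj_mult mult.assoc)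
  then have "complex_of_real ((norm (scaleC c x))\<^sup>2) = of_real ((cmod c * norm x)\<^sup>2)"
    unfolding cinner_self complex_norm_square[symmetric] by (simp add: power_mult_distrib)
  then have "(norm (scaleC c x))\<^sup>2 = (cmod c * norm x)\<^sup>2"
    using of_real_eq_iff by blast
  then show ?thesis
    by (simp add: power2_eq_iff_nonneg)
qed

lemma cmod_cinner_le: "2 * cmod (cinner x y) \<le> (norm x)\<^sup>2 + (norm y)\<^sup>2"
  for x y :: "'a::complex_hilbert"
proof -
  define c where "c = (if cinner x y = 0 then 1 else cnj (cinner x y) / cmod (cinner x y))"
  have c: "cmod c = 1" by (simp add: c_def norm_divide)
  have "c * cinner x y = of_real (cmod (cinner x y))"
    by (simp add: c_def complex_norm_square[symmetric] power2_eq_square mult.commute)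
  then have "inner (scaleC c x) y = cmod (cinner x y)"
    by (simp add: inner_eq_Re_cinner cinner_scaleC_left)
  moreover have "inner (scaleC c x) y \<le> norm (scaleC c x) * norm y"
    by (rule norm_cauchy_schwarz)
  moreover have "2 * (norm x * norm y) \<le> (norm x)\<^sup>2 + (norm y)\<^sup>2"
    using sum_squares_bound[of "norm x" "norm y"] by simp
  ultimately show ?thesis by (simp add: norm_scaleC c)
qed

instantiation complex :: complex_hilbert
begin
definition "scaleC_complex = (\<lambda>(c::complex) x. c * x)"
definition "cinner_complex = (\<lambda>x y :: complex. x * cnj y)"
instance
  by standard (auto simp: scaleC_complex_def cinner_complex_def algebra_simps inner_complex_def
      scaleR_conv_of_real)
end

instantiation prod :: (complex_hilbert, complex_hilbert) complex_hilbert
begin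
definition "scaleC_prod = (\<lambda>c (x :: 'a \<times> 'b). (scaleC c (fst x), scaleC c (snd x)))"
definition "cinner_prod = (\<lambda>x y :: 'a \<times> 'b. cinner (fst x) (fst y) + cinner (snd x) (snd y))"
instance
proof (standard, goal_cases)
  case (5 x y)
  show ?case
    unfolding cinner_prod_def
    using cinner_commute[of "fst x" "fst y"] cinner_commute[of "snd x" "snd y"] by simp
qed (auto simp: scaleC_prod_def cinner_prod_def algebra_simps inner_prod_def prod_eq_iff
      scaleC_add_right scaleC_add_left scaleC_scaleC scaleR_scaleC cinner_add_left
      cinner_scaleC_left inner_eq_Re_cinner)
end

text \<open>The Hilbert spaces lying inside a given one.\<close>

definition closed_csubspace :: "'a::complex_hilbert set \<Rightarrow> bool" where
  "closed_csubspace X \<longleftrightarrow> closed X \<and> 0 \<in> X \<and> (\<forall>x\<in>X. \<forall>y\<in>X. x + y \<in> X) \<and>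
     (\<forall>c. \<forall>x\<in>X. scaleC c x \<in> X)"

text \<open>Bounded operators from \<open>X\<close> to \<open>Y\<close>; their values outside \<open>X\<close> are irrelevant.\<close>

definition bounded_ops ::
  "'a::complex_hilbert set \<Rightarrow> 'b::complex_hilbert set \<Rightarrow> ('a \<Rightarrow> 'b) set" where
  "bounded_ops X Y = {R. (\<forall>x\<in>X. R x \<in> Y) \<and>
     (\<forall>x\<in>X. \<forall>y\<in>X. R (x + y) = R x + R y) \<and>
     (\<forall>c. \<forall>x\<in>X. R (scaleC c x) = scaleC c (R x)) \<and>
     (\<exists>K. \<forall>x\<in>X. norm (R x) \<le> K * norm x)}"

definition adjoint_on ::
  "'a::complex_hilbert set \<Rightarrow> 'b::complex_hilbert set \<Rightarrow> ('a \<Rightarrow> 'b) \<Rightarrow> 'b \<Rightarrow> 'a" where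
  "adjoint_on X Y R y =
     (if y \<in> Y then THE x. x \<in> X \<and> (\<forall>z\<in>X. cinner (R z) y = cinner z x) else 0)"

definition coisometry_on ::
  "'a::complex_hilbert set \<Rightarrow> 'b::complex_hilbert set \<Rightarrow> ('a \<Rightarrow> 'b) \<Rightarrow> bool" where
  "coisometry_on X Y R \<longleftrightarrow> R \<in> bounded_ops X Y \<and> (\<forall>y\<in>Y. R (adjoint_on X Y R y) = y)"


section \<open>Hilbert direct sums\<close>

definition square_summable :: "('i \<Rightarrow> 'e::complex_hilbert) \<Rightarrow> bool" where
  "square_summable f \<longleftrightarrow> (\<lambda>i. (norm (f i))\<^sup>2) summable_on UNIV"

lemma square_summable_0: "square_summable (\<lambda>_. 0)"
  by (simp add: square_summable_def)

lemma square_summable_le: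
  assumes "square_summable f" and "\<And>i. norm (g i) \<le> c * norm (f i)"
  shows "square_summable g"
  unfolding square_summable_def
proof (rule summable_on_comparison_test)
  show "(\<lambda>i. c\<^sup>2 * (norm (f i))\<^sup>2) summable_on UNIV"
    using assms(1) unfolding square_summable_def by (rule summable_on_cmult_right)
  show "(norm (g i))\<^sup>2 \<le> c\<^sup>2 * (norm (f i))\<^sup>2" for i
    using power_mono[OF assms(2)[of i], of 2] by (simp add: power_mult_distrib)
qed auto

lemma square_summable_add:
  assumes "square_summable f" and "square_summable g"
  shows "square_summable (\<lambda>i. f i + g i)"
  unfolding square_summable_def
proof (rule summable_on_comparison_test)
  show "(\<lambda>i. 2 * ((norm (f i))\<^sup>2 + (norm (g i))\<^sup>2)) summable_on UNIV"
    using assms unfolding square_summable_def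
    by (intro summable_on_cmult_right summable_on_add)
  show "(norm (f i + g i))\<^sup>2 \<le> 2 * ((norm (f i))\<^sup>2 + (norm (g i))\<^sup>2)" for i
  proof -
    have "(norm (f i + g i))\<^sup>2 \<le> (norm (f i) + norm (g i))\<^sup>2"
      by (simp add: norm_triangle_ineq power_mono)
    also have "\<dots> \<le> 2 * ((norm (f i))\<^sup>2 + (norm (g i))\<^sup>2)"
      using sum_squares_bound[of "norm (f i)" "norm (g i)"] by (simp add: power2_sum)
    finally show ?thesis .
  qed
qed auto

lemma square_summable_scaleC: "square_summable f \<Longrightarrow> square_summable (\<lambda>i. scaleC c (f i))"
  by (rule square_summable_le[where c = "cmod c"]) (auto simp: norm_scaleC)

lemma square_summable_scaleR: "square_summable f \<Longrightarrow> square_summable (\<lambda>i. scaleR r (f i))"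
  by (simp add: scaleR_scaleC square_summable_scaleC)

lemma square_summable_minus: "square_summable f \<Longrightarrow> square_summable (\<lambda>i. - f i)"
  by (simp add: square_summable_def)

lemma square_summable_diff:
  "square_summable f \<Longrightarrow> square_summable g \<Longrightarrow> square_summable (\<lambda>i. f i - g i)"
  using square_summable_add[of f "\<lambda>i. - g i"] square_summable_minus[of g] by simp

lemma square_summable_cinner:
  assumes "square_summable f" and "square_summable g"
  shows "(\<lambda>i. cinner (f i) (g i)) summable_on UNIV"
proof (rule abs_summable_summable, rule summable_on_comparison_test)
  show "(\<lambda>i. (norm (f i))\<^sup>2 + (norm (g i))\<^sup>2) summable_on UNIV"
    using assms unfolding square_summable_def by (rule summable_on_add)
  show "cmod (cinner (f i) (g i)) \<le> (norm (f i))\<^sup>2 + (norm (g i))\<^sup>2" for i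
    using cmod_cinner_le[of "f i" "g i"] norm_ge_zero[of "cinner (f i) (g i)"] by linarith
qed auto

text \<open>\<open>('i, 'e) l2sum\<close> is the Hilbert direct sum of copies of \<open>'e\<close> indexed by \<open>'i\<close>.\<close>

typedef (overloaded) ('i, 'e::complex_hilbert) l2sum = "{f :: 'i \<Rightarrow> 'e. square_summable f}"
  morphisms l2_nth Abs_l2sum
  using square_summable_0 by blast

setup_lifting type_definition_l2sum

instantiation l2sum :: (type, complex_hilbert) real_inner
begin
lift_definition zero_l2sum :: "('a, 'b) l2sum" is "\<lambda>_. 0"
  by (rule square_summable_0)
lift_definition plus_l2sum :: "('a, 'b) l2sum \<Rightarrow> ('a, 'b) l2sum \<Rightarrow> ('a, 'b) l2sum"
  is "\<lambda>f g i. f i + g i" by (rule square_summable_add)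
lift_definition minus_l2sum :: "('a, 'b) l2sum \<Rightarrow> ('a, 'b) l2sum \<Rightarrow> ('a, 'b) l2sum"
  is "\<lambda>f g i. f i - g i" by (rule square_summable_diff)
lift_definition uminus_l2sum :: "('a, 'b) l2sum \<Rightarrow> ('a, 'b) l2sum"
  is "\<lambda>f i. - f i" by (rule square_summable_minus)
lift_definition scaleR_l2sum :: "real \<Rightarrow> ('a, 'b) l2sum \<Rightarrow> ('a, 'b) l2sum"
  is "\<lambda>r f i. scaleR r (f i)" by (rule square_summable_scaleR)
lift_definition inner_l2sum :: "('a, 'b) l2sum \<Rightarrow> ('a, 'b) l2sum \<Rightarrow> real"
  is "\<lambda>f g. \<Sum>\<^sub>\<infinity>i. inner (f i) (g i)" .
lift_definition norm_l2sum :: "('a, 'b) l2sum \<Rightarrow> real"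
  is "\<lambda>f. sqrt (\<Sum>\<^sub>\<infinity>i. (norm (f i))\<^sup>2)" .
definition "dist_l2sum = (\<lambda>f g :: ('a, 'b) l2sum. norm (f - g))"
definition "sgn_l2sum = (\<lambda>f :: ('a, 'b) l2sum. scaleR (inverse (norm f)) f)"
definition [code del]:
  "(uniformity :: (('a, 'b) l2sum \<times> ('a, 'b) l2sum) filter) =
     (INF e\<in>{0 <..}. principal {(x, y). dist x y < e})"
definition [code del]:
  "open (U :: ('a, 'b) l2sum set) \<longleftrightarrow>
     (\<forall>x\<in>U. eventually (\<lambda>(x', y). x' = x \<longrightarrow> y \<in> U) uniformity)"

lemma square_summable_inner:
  assumes "square_summable f" and "square_summable g"
  shows "(\<lambda>i. inner (f i) (g i)) summable_on UNIV"
  unfolding inner_eq_Re_cinner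
  by (rule summable_on_Re) (rule square_summable_cinner[OF assms])

instance
proof
  fix x y z :: "('a, 'b) l2sum" and r s :: real
  show "x + y + z = x + (y + z)" "x + y = y + x" "0 + x = x" "- x + x = 0" "x - y = x + - y"
    "scaleR r (x + y) = scaleR r x + scaleR r y" "scaleR (r + s) x = scaleR r x + scaleR s x"
    "scaleR r (scaleR s x) = scaleR (r * s) x" "scaleR 1 x = x"
    by (transfer; simp add: algebra_simps)+
  show "dist x y = norm (x - y)" "sgn x = scaleR (inverse (norm x)) x"
    by (simp_all add: dist_l2sum_def sgn_l2sum_def)
  show "(uniformity :: (('a, 'b) l2sum \<times> ('a, 'b) l2sum) filter) =
     (INF e\<in>{0 <..}. principal {(x, y). dist x y < e})"
    by (rule uniformity_l2sum_def)
  show "open U \<longleftrightarrow> (\<forall>x\<in>U. eventually (\<lambda>(x', y). x' = x \<longrightarrow> y \<in> U) uniformity)"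
    for U :: "('a, 'b) l2sum set"
    by (rule open_l2sum_def)
  show "inner x y = inner y x"
    by transfer (simp add: inner_commute)
  show "inner (x + y) z = inner x z + inner y z"
    by transfer (simp add: inner_add_left infsum_add square_summable_inner)
  show "inner (scaleR r x) y = r * inner x y"
    by transfer (simp add: infsum_cmult_right')
  show "0 \<le> inner x x"
    by transfer (simp add: infsum_nonneg)
  have "x = 0" if "inner x x = 0"
  proof -
    have "inner (l2_nth x i) (l2_nth x i) = 0" for i
      using that l2_nth[of x] unfolding inner_l2sum.rep_eq
      by (intro nonneg_infsum_le_0D[of "\<lambda>i. inner (l2_nth x i) (l2_nth x i)" UNIV])
        (auto intro!: square_summable_inner)
    then have "l2_nth x = l2_nth 0"
      by (auto simp: zero_l2sum.rep_eq)
    then show ?thesis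
      by (simp add: l2_nth_inject)
  qed
  moreover have "inner (0 :: ('a, 'b) l2sum) 0 = 0"
    by transfer simp
  ultimately show "inner x x = 0 \<longleftrightarrow> x = 0"
    by blast
  show "norm x = sqrt (inner x x)"
    by transfer (simp add: power2_norm_eq_inner)
qed
end

lemma square_summable_nth: "square_summable (l2_nth f)"
  using l2_nth[of f] by simp

lemma l2_nth_diff: "l2_nth (f - g) i = l2_nth f i - l2_nth g i"
  by transfer simp

lemma sum_norm_nth_le:
  assumes "finite S" shows "(\<Sum>i\<in>S. (norm (l2_nth f i))\<^sup>2) \<le> (norm f)\<^sup>2"
proof -
  have "(\<Sum>i\<in>S. (norm (l2_nth f i))\<^sup>2) \<le> (\<Sum>\<^sub>\<infinity>i. (norm (l2_nth f i))\<^sup>2)"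
    using square_summable_nth[of f] assms
    by (intro finite_sum_le_infsum) (auto simp: square_summable_def)
  also have "\<dots> = (norm f)\<^sup>2"
    by transfer (simp add: infsum_nonneg)
  finally show ?thesis .
qed

lemma norm_nth_le: "norm (l2_nth f i) \<le> norm f"
  using sum_norm_nth_le[of "{i}" f] by (simp add: power2_le_iff_abs_le)

lemma l2sum_of_bounded_sums:
  fixes g :: "'i \<Rightarrow> 'e::complex_hilbert"
  assumes "0 \<le> e" and "\<And>S. finite S \<Longrightarrow> (\<Sum>i\<in>S. (norm (g i))\<^sup>2) \<le> e\<^sup>2"
  shows "square_summable g" and "norm (Abs_l2sum g) \<le> e"
proof -
  show g: "square_summable g"
    unfolding square_summable_def
    by (rule nonneg_bdd_above_summable_on) (auto intro!: bdd_aboveI2 assms(2))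
  have "(\<Sum>\<^sub>\<infinity>i. (norm (g i))\<^sup>2) \<le> e\<^sup>2"
    using g unfolding square_summable_def
    by (rule infsum_le_finite_sums) (auto intro: assms(2))
  then have "sqrt (\<Sum>\<^sub>\<infinity>i. (norm (g i))\<^sup>2) \<le> e"
    using assms(1) by (rule real_le_lsqrt[rotated])
  then show "norm (Abs_l2sum g) \<le> e"
    by (simp add: norm_l2sum.rep_eq Abs_l2sum_inverse g)
qed

instance l2sum :: (type, complex_hilbert) complete_space
proof
  fix X :: "nat \<Rightarrow> ('a, 'b) l2sum"
  assume X: "Cauchy X"
  have "Cauchy (\<lambda>n. l2_nth (X n) i)" for i
  proof (rule metric_CauchyI)
    fix e :: real assume "0 < e"
    then obtain M where "\<forall>m\<ge>M. \<forall>n\<ge>M. dist (X m) (X n) < e"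
      using X unfolding Cauchy_def by blast
    moreover have "dist (l2_nth (X m) i) (l2_nth (X n) i) \<le> dist (X m) (X n)" for m n
      unfolding dist_norm using norm_nth_le[of "X m - X n" i] by (simp add: l2_nth_diff)
    ultimately show "\<exists>M. \<forall>m\<ge>M. \<forall>n\<ge>M. dist (l2_nth (X m) i) (l2_nth (X n) i) < e"
      by (meson order_le_less_trans)
  qed
  then have "\<forall>i. \<exists>l. (\<lambda>n. l2_nth (X n) i) \<longlonglongrightarrow> l"
    using Cauchy_convergent convergent_def by blast
  then obtain g where g: "\<And>i. (\<lambda>n. l2_nth (X n) i) \<longlonglongrightarrow> g i"
    by metis
  have key: "\<exists>M. \<forall>n\<ge>M. \<forall>S. finite S \<longrightarrow> (\<Sum>i\<in>S. (norm (l2_nth (X n) i - g i))\<^sup>2) \<le> e\<^sup>2"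
    if "0 < e" for e :: real
  proof -
    obtain M where M: "\<forall>m\<ge>M. \<forall>n\<ge>M. dist (X m) (X n) < e"
      using X \<open>0 < e\<close> unfolding Cauchy_def by blast
    show ?thesis
    proof (intro exI[of _ M] allI impI)
      fix n S assume n: "M \<le> n" and "finite (S :: 'a set)"
      have "(\<lambda>m. \<Sum>i\<in>S. (norm (l2_nth (X n) i - l2_nth (X m) i))\<^sup>2)
          \<longlonglongrightarrow> (\<Sum>i\<in>S. (norm (l2_nth (X n) i - g i))\<^sup>2)"
        by (intro tendsto_intros g)
      moreover have "(\<Sum>i\<in>S. (norm (l2_nth (X n) i - l2_nth (X m) i))\<^sup>2) \<le> e\<^sup>2" if "M \<le> m" for m
      proof -
        have "(\<Sum>i\<in>S. (norm (l2_nth (X n) i - l2_nth (X m) i))\<^sup>2) \<le> (norm (X n - X m))\<^sup>2"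
          using sum_norm_nth_le[OF \<open>finite S\<close>, of "X n - X m"] by (simp add: l2_nth_diff)
        also have "\<dots> \<le> e\<^sup>2"
          using M n that by (intro power_mono) (auto simp: dist_norm less_imp_le)
        finally show ?thesis .
      qed
      ultimately show "(\<Sum>i\<in>S. (norm (l2_nth (X n) i - g i))\<^sup>2) \<le> e\<^sup>2"
        by (intro LIMSEQ_le_const2) blast+
    qed
  qed
  have ss: "square_summable g"
  proof -
    obtain n where "\<And>S. finite S \<Longrightarrow> (\<Sum>i\<in>S. (norm (l2_nth (X n) i - g i))\<^sup>2) \<le> 1\<^sup>2"
      using key[of 1] by auto
    then have "square_summable (\<lambda>i. l2_nth (X n) i - g i)"
      by (intro l2sum_of_bounded_sums(1)[of 1]) auto
    then show ?thesis
      using square_summable_diff[OF square_summable_nth[of "X n"]] by fastforce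
  qed
  have "X \<longlonglongrightarrow> Abs_l2sum g"
  proof (rule metric_LIMSEQ_I)
    fix e :: real assume "0 < e"
    then obtain M where M: "\<forall>n\<ge>M. \<forall>S. finite S \<longrightarrow>
        (\<Sum>i\<in>S. (norm (l2_nth (X n) i - g i))\<^sup>2) \<le> (e / 2)\<^sup>2"
      using key[of "e / 2"] by auto
    have "dist (X n) (Abs_l2sum g) < e" if "M \<le> n" for n
    proof -
      have "X n - Abs_l2sum g = Abs_l2sum (\<lambda>i. l2_nth (X n) i - g i)"
        by (simp add: minus_l2sum_def ss Abs_l2sum_inverse)
      moreover have "norm (Abs_l2sum (\<lambda>i. l2_nth (X n) i - g i)) \<le> e / 2"
        using M that \<open>0 < e\<close> by (intro l2sum_of_bounded_sums(2)) auto
      ultimately show ?thesis using \<open>0 < e\<close> by (simp add: dist_norm)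
    qed
    then show "\<exists>M. \<forall>n\<ge>M. dist (X n) (Abs_l2sum g) < e" by blast
  qed
  then show "convergent X" by (rule convergentI)
qed

instantiation l2sum :: (type, complex_hilbert) complex_hilbert
begin
lift_definition scaleC_l2sum :: "complex \<Rightarrow> ('a, 'b) l2sum \<Rightarrow> ('a, 'b) l2sum"
  is "\<lambda>c f i. scaleC c (f i)" by (rule square_summable_scaleC)
lift_definition cinner_l2sum :: "('a, 'b) l2sum \<Rightarrow> ('a, 'b) l2sum \<Rightarrow> complex"
  is "\<lambda>f g. \<Sum>\<^sub>\<infinity>i. cinner (f i) (g i)" .
instance
proof
  fix x y z :: "('a, 'b) l2sum" and c d :: complex and r :: real
  show "scaleC c (x + y) = scaleC c x + scaleC c y" "scaleC (c + d) x = scaleC c x + scaleC d x"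
    "scaleC c (scaleC d x) = scaleC (c * d) x" "scaleR r x = scaleC (of_real r) x"
    by (transfer; simp add: scaleC_add_right scaleC_add_left scaleC_scaleC scaleR_scaleC)+
  show "cinner x y = cnj (cinner y x)"
    by transfer (simp add: cinner_commute[symmetric] flip: infsum_cnj)
  show "cinner (x + y) z = cinner x z + cinner y z"
    by transfer (simp add: cinner_add_left infsum_add square_summable_cinner)
  show "cinner (scaleC c x) y = c * cinner x y"
    by transfer (simp add: cinner_scaleC_left infsum_cmult_right')
  show "inner x y = Re (cinner x y)"
    by transfer (simp add: inner_eq_Re_cinner infsum_Re square_summable_cinner)
qed
end


section \<open>Word-indexed direct sums and amplification\<close>

text \<open>The \<open>N \<ge> 1\<close> letters are the elements of the finite type \<open>'n\<close>, so \<open>N = CARD('n)\<close>, and words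
  are lists of letters; only their lengths and first letters matter below, so no order on the words
  is needed. \<open>('n, 'e) fock\<close> is the direct sum of all the spaces \<open>\<H>\<^sub>k \<otimes> \<E>\<close> (\<open>k \<ge> 0\<close>), and
  \<open>\<H>\<^sub>k \<otimes> \<E>\<close>, a direct sum of copies of \<open>\<E>\<close> indexed by the words of length \<open>k\<close>, is the
  subspace of the families supported on these words.\<close>

type_synonym ('n, 'e) fock = "('n list, 'e) l2sum"

definition level :: "nat \<Rightarrow> 'e::complex_hilbert set \<Rightarrow> ('n::finite, 'e) fock set" where
  "level k F = {f. \<forall>w. l2_nth f w \<in> F \<and> (length w \<noteq> k \<longrightarrow> l2_nth f w = 0)}"

lift_definition proj_level :: "nat \<Rightarrow> ('n::finite, 'e::complex_hilbert) fock \<Rightarrow> ('n, 'e) fock"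
  is "\<lambda>k f w. if length w = k then f w else 0"
  by (auto elim: square_summable_le[where c = 1])

text \<open>\<open>prepend j\<close> is the inclusion of the \<open>j\<close>-th copy of \<open>\<H>\<^sub>k \<otimes> \<E>\<close> into \<open>\<H>\<^sub>k\<^sub>+\<^sub>1 \<otimes> \<E>\<close>, for all
  \<open>k\<close> at once, and \<open>strip j\<close> is the projection onto this copy.\<close>

lift_definition strip :: "'n::finite \<Rightarrow> ('n, 'e::complex_hilbert) fock \<Rightarrow> ('n, 'e) fock"
  is "\<lambda>j f w. f (j # w)"
proof -
  fix j :: 'n and f :: "'n list \<Rightarrow> 'e" assume "square_summable f"
  then have "(\<lambda>w. (norm (f w))\<^sup>2) summable_on range (Cons j)"
    unfolding square_summable_def by (auto intro: summable_on_subset_banach)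
  then show "square_summable (\<lambda>w. f (j # w))"
    by (subst (asm) summable_on_reindex) (auto simp: square_summable_def o_def)
qed

lift_definition prepend :: "'n::finite \<Rightarrow> ('n, 'e::complex_hilbert) fock \<Rightarrow> ('n, 'e) fock"
  is "\<lambda>j f w. case w of [] \<Rightarrow> 0 | k # v \<Rightarrow> if k = j then f v else 0"
proof -
  fix j :: 'n and f :: "'n list \<Rightarrow> 'e" assume "square_summable f"
  then have "((\<lambda>w. (norm (f (tl w)))\<^sup>2) \<circ> Cons j) summable_on UNIV"
    by (simp add: square_summable_def o_def)
  then have "(\<lambda>w. (norm (f (tl w)))\<^sup>2) summable_on range (Cons j)"
    by (subst summable_on_reindex) auto
  then show "square_summable (\<lambda>w. case w of [] \<Rightarrow> 0 | k # v \<Rightarrow> if k = j then f v else 0)"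
    unfolding square_summable_def
    by (rule summable_on_cong_neutral[THEN iffD1, rotated -1]) (auto split: list.splits if_splits)
qed

text \<open>\<open>ampl R\<close> is the direct sum of \<open>N\<close> copies of \<open>R\<close>: if \<open>R\<close> acts from \<open>\<H>\<^sub>k \<otimes> \<E>\<close> to
  \<open>\<H>\<^sub>l \<otimes> \<E>'\<close>, then \<open>ampl R\<close> acts from \<open>\<H>\<^sub>k\<^sub>+\<^sub>1 \<otimes> \<E>\<close> to \<open>\<H>\<^sub>l\<^sub>+\<^sub>1 \<otimes> \<E>'\<close>.\<close>

definition ampl ::
  "(('n::finite, 'a::complex_hilbert) fock \<Rightarrow> ('n, 'b::complex_hilbert) fock) \<Rightarrow>
    ('n, 'a) fock \<Rightarrow> ('n, 'b) fock" where
  "ampl R f = (\<Sum>j\<in>UNIV. prepend j (R (strip j f)))"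


section \<open>The class \<open>\<S>(\<H>, \<E>\<^sub>1, \<E>\<^sub>2)\<close>\<close>

definition block ::
  "(('n::finite, 'a::complex_hilbert) fock \<Rightarrow> ('n, 'b::complex_hilbert) fock) \<Rightarrow>
    nat \<Rightarrow> nat \<Rightarrow> ('n, 'a) fock \<Rightarrow> ('n, 'b) fock" where
  "block T i j f = proj_level i (T (proj_level j f))"

definition schur_class ::
  "(('n::finite, 'e1::complex_hilbert) fock \<Rightarrow> ('n, 'e2::complex_hilbert) fock) set" where
  "schur_class = {T. T \<in> bounded_ops UNIV UNIV \<and> (\<forall>f. norm (T f) \<le> norm f) \<and>
     (\<forall>i j. j < i \<longrightarrow> (\<forall>f\<in>level j UNIV. block T i j f = 0)) \<and>
     (\<forall>i j. 1 \<le> i \<and> i \<le> j \<longrightarrow>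
        (\<forall>f\<in>level j UNIV. block T i j f = ampl (block T (i - 1) (j - 1)) f))}"


section \<open>The class \<open>\<B>\<S>\<^sub>N(\<E>\<^sub>1, \<E>\<^sub>2, \<F>)\<close> and transfer maps\<close>

text \<open>The state space \<open>\<F>\<close> is a closed subspace \<open>F\<close> of the Hilbert space \<open>'f\<close>. The direct
  sum of \<open>N\<^sup>n\<close> copies of \<open>\<F>\<close> is \<open>level n F\<close>; in particular \<open>\<F>\<close> itself appears as \<open>level 0 F\<close>.\<close>

record (overloaded) ('n, 'e1, 'e2, 'f) system =
  sysA :: "nat \<Rightarrow> ('n, 'f::complex_hilbert) fock \<Rightarrow> ('n, 'f) fock"
  sysB :: "nat \<Rightarrow> ('n, 'e2::complex_hilbert) fock \<Rightarrow> ('n, 'f) fock"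
  sysC :: "nat \<Rightarrow> ('n, 'f) fock \<Rightarrow> ('n, 'e1::complex_hilbert) fock"
  sysD :: "nat \<Rightarrow> ('n, 'e2) fock \<Rightarrow> ('n, 'e1) fock"

definition system_matrix ::
  "('n::finite, 'e1::complex_hilbert, 'e2::complex_hilbert, 'f::complex_hilbert) system \<Rightarrow> nat \<Rightarrow>
    ('n, 'f) fock \<times> ('n, 'e2) fock \<Rightarrow> ('n, 'f) fock \<times> ('n, 'e1) fock" where
  "system_matrix \<Sigma> n =
     (\<lambda>(x, u). (sysA \<Sigma> n x + sysB \<Sigma> n u, sysC \<Sigma> n x + sysD \<Sigma> n u))"

definition BS_class :: "'f::complex_hilbert set \<Rightarrow>
    ('n::finite, 'e1::complex_hilbert, 'e2::complex_hilbert, 'f) system set" where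
  "BS_class F = {\<Sigma>.
     sysA \<Sigma> 0 \<in> bounded_ops (level 0 F) (level 1 F) \<and>
     sysB \<Sigma> 0 \<in> bounded_ops (level 0 UNIV) (level 1 F) \<and>
     sysC \<Sigma> 0 \<in> bounded_ops (level 0 F) (level 0 UNIV) \<and>
     sysD \<Sigma> 0 \<in> bounded_ops (level 0 UNIV) (level 0 UNIV) \<and>
     (\<forall>n\<ge>1.
        (\<forall>x\<in>level n F. sysA \<Sigma> n x = ampl (sysA \<Sigma> (n - 1)) x) \<and>
        (\<forall>u\<in>level n UNIV. sysB \<Sigma> n u = ampl (sysB \<Sigma> (n - 1)) u) \<and>
        (\<forall>x\<in>level n F. sysC \<Sigma> n x = ampl (sysC \<Sigma> (n - 1)) x) \<and>
        (\<forall>u\<in>level n UNIV. sysD \<Sigma> n u = ampl (sysD \<Sigma> (n - 1)) u)) \<and>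
     (\<forall>n. coisometry_on (level n F \<times> level n UNIV) (level (Suc n) F \<times> level n UNIV)
        (system_matrix \<Sigma> n))}"

text \<open>An input \<open>u\<close> stands for the sequence of its components \<open>u(n) = proj_level n u\<close>.\<close>

primrec state_seq ::
  "('n::finite, 'e1::complex_hilbert, 'e2::complex_hilbert, 'f::complex_hilbert) system \<Rightarrow>
    ('n, 'e2) fock \<Rightarrow> nat \<Rightarrow> ('n, 'f) fock" where
  "state_seq \<Sigma> u 0 = 0"
| "state_seq \<Sigma> u (Suc n) = sysA \<Sigma> n (state_seq \<Sigma> u n) + sysB \<Sigma> n (proj_level n u)"

definition output_seq ::
  "('n::finite, 'e1::complex_hilbert, 'e2::complex_hilbert, 'f::complex_hilbert) system \<Rightarrow>
    ('n, 'e2) fock \<Rightarrow> nat \<Rightarrow> ('n, 'e1) fock" where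
  "output_seq \<Sigma> u n = sysC \<Sigma> n (state_seq \<Sigma> u n) + sysD \<Sigma> n (proj_level n u)"

text \<open>An operator is determined by the components of its values, so at most one \<open>S\<close> satisfies
  the following.\<close>

definition is_transfer_map ::
  "('n::finite, 'e1::complex_hilbert, 'e2::complex_hilbert, 'f::complex_hilbert) system \<Rightarrow>
    (('n, 'e2) fock \<Rightarrow> ('n, 'e1) fock) \<Rightarrow> bool" where
  "is_transfer_map \<Sigma> S \<longleftrightarrow> (\<forall>u n. proj_level n (S u) = output_seq \<Sigma> u n)"

end

theory Submission
  imports Defs
begin

text \<open>Let \<open>S = T\<^sup>*\<close>. Membership of \<open>T\<close> in the Schur class means that \<open>S\<close> is a contraction
  commuting with the left creation operators \<open>prepend j\<close>. For the transfer map of a system,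
  contractivity is the energy balance of the coisometric steps, and commutation holds because
  prepending a letter to the input shifts the trajectory by one time step.

  Conversely, let \<open>\<Delta>\<close> be the square root of \<open>1 - S T\<close>, and let the state space be the closure of
  the range of \<open>\<Delta>\<close>. The de Branges-Rovnyak model has \<open>\<Delta> (A j x) = strip j (\<Delta> x)\<close> and
  \<open>\<Delta> (B j u) = strip j (S u)\<close>, while \<open>C\<close> and \<open>D\<close> evaluate \<open>\<Delta> x\<close> and \<open>S u\<close> at the empty word. Its
  transfer map is \<open>S\<close> because, for the input \<open>u\<close>, the state \<open>x\<close> at the word \<open>w\<close> satisfies
  \<open>\<Delta> x + S (fold strip w u) = fold strip w (S u)\<close>.\<close>

section \<open>Complex inner products\<close>

text \<open>Two sides of a word are at work: \<open>ampl\<close> makes copies indexed by the first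
  letter, while a step of the model adds a letter at the end. These operations are compatible, so
  one pair of operators acting at the end of words serves at every time.

  The operators \<open>A j\<close> and \<open>B j\<close> come from an inequality. As
  \<open>\<Delta>\<close> is self-adjoint with square 1 - S T, the squared norm of
  \<open>\<Delta> f\<close> is that of \<open>f\<close> minus that of \<open>T f\<close>. Prepending
  preserves norms, and \<open>T (prepend j f)\<close> contains a copy of \<open>T f\<close> besides
  its value at the empty word. Hence the squared norms of \<open>\<Delta> (prepend j f)\<close> and
  of that value add up to at most the squared norm of \<open>\<Delta> f\<close>. Both vectors are
  therefore contractive functions of \<open>\<Delta> f\<close>, and \<open>A j\<close>,
  \<open>B j\<close> are the adjoints of these functions.

  Being a coisometry then costs one identity. On a dense set, the adjoint of the system produces
  pairs consisting of \<open>\<Delta> g\<close> and the value of \<open>T g\<close> at the empty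
  word; the system returns from such a pair \<open>\<Delta> (strip i g)\<close> and the value of
  \<open>g\<close> at the empty word. The state part is verified only under \<open>\<Delta>\<close>,
  which is why the state space is a space on which \<open>\<Delta>\<close> is injective.\<close>

lemma cinner_add_right: "cinner x (y + z) = cinner x y + cinner x z"
  for x y z :: "'a::complex_hilbert"
  by (metis cinner_add_left cinner_commute complex_cnj_add)

lemma cinner_scaleC_right: "cinner x (scaleC c y) = cnj c * cinner x y"
  for x y :: "'a::complex_hilbert"
  by (metis cinner_scaleC_left cinner_commute complex_cnj_mult)

lemma scaleC_minus_one: "scaleC (- 1) x = - x" for x :: "'a::complex_hilbert"
  using scaleR_scaleC[of "- 1" x] by simp

lemma scaleC_0_right [simp]: "scaleC c (0 :: 'a::complex_hilbert) = 0"
  using scaleC_add_right[of c "0 :: 'a" 0] by simp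

lemma scaleC_0_left [simp]: "scaleC 0 (x :: 'a::complex_hilbert) = 0"
  using scaleR_scaleC[of 0 x] by simp

lemma scaleC_minus_right: "scaleC c (- x) = - scaleC c x" for x :: "'a::complex_hilbert"
  by (metis add.right_inverse add_eq_0_iff scaleC_0_right scaleC_add_right)

lemma scaleC_diff_right: "scaleC c (x - y) = scaleC c x - scaleC c y"
  for x y :: "'a::complex_hilbert"
  using scaleC_add_right[of c x "- y"] by (simp add: scaleC_minus_right)

lemma scaleC_sum_right: "scaleC c (\<Sum>i\<in>I. f i) = (\<Sum>i\<in>I. scaleC c (f i))"
  for f :: "'i \<Rightarrow> 'a::complex_hilbert"
  by (induction I rule: infinite_finite_induct) (auto simp: scaleC_add_right)

lemma cinner_zero_left [simp]: "cinner 0 (x :: 'a::complex_hilbert) = 0"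
  using cinner_add_left[of 0 0 x] by simp

lemma cinner_zero_right [simp]: "cinner (x :: 'a::complex_hilbert) 0 = 0"
  using cinner_add_right[of x 0 0] by simp

lemma cinner_minus_left: "cinner (- x) y = - cinner x y" for x y :: "'a::complex_hilbert"
  using cinner_add_left[of x "- x" y] by (simp add: eq_neg_iff_add_eq_0 add.commute)

lemma cinner_diff_left: "cinner (x - y) z = cinner x z - cinner y z"
  for x y z :: "'a::complex_hilbert"
  using cinner_add_left[of x "- y" z] by (simp add: cinner_minus_left)

lemma cinner_diff_right: "cinner x (y - z) = cinner x y - cinner x z"
  for x y z :: "'a::complex_hilbert"
  by (metis cinner_diff_left cinner_commute complex_cnj_diff)

lemma cinner_sum_left: "cinner (\<Sum>i\<in>I. f i) x = (\<Sum>i\<in>I. cinner (f i) x)"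
  for x :: "'a::complex_hilbert"
  by (induction I rule: infinite_finite_induct) (auto simp: cinner_add_left)

lemma cinner_sum_right: "cinner x (\<Sum>i\<in>I. f i) = (\<Sum>i\<in>I. cinner x (f i))"
  for x :: "'a::complex_hilbert"
  by (induction I rule: infinite_finite_induct) (auto simp: cinner_add_right)

text \<open>Since \<open>Re (\<i> * z) = - Im z\<close>, the real inner products at \<open>p\<close>
  and at \<open>scaleC \<i> p\<close> carry the real and the imaginary part. Results about the
  underlying real Hilbert space are lifted to \<open>cinner\<close> in this way.\<close>

lemma cinner_eqI_inner:
  fixes p q :: "'a::complex_hilbert" and r s :: "'b::complex_hilbert"
  assumes "inner p q = inner r s" and "inner (scaleC \<i> p) q = inner (scaleC \<i> r) s"
  shows "cinner p q = cinner r s"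
  using assms by (simp add: inner_eq_Re_cinner cinner_scaleC_left complex_eq_iff)

lemma cinner_extensionality:
  fixes x y :: "'a::complex_hilbert"
  assumes "\<And>z. cinner z x = cinner z y"
  shows "x = y"
proof -
  have "cinner (x - y) (x - y) = 0"
    using assms by (simp add: cinner_diff_right)
  then show ?thesis
    by (simp add: cinner_self)
qed

lemma norm_eq_if_cinner_self_eq:
  fixes x :: "'a::complex_hilbert" and y :: "'b::complex_hilbert"
  assumes "cinner x x = cinner y y" shows "norm x = norm y"
  using assms by (simp add: cinner_self del: of_real_power)

section \<open>Bounded operators\<close>

lemma closed_csubspaceD:
  assumes "closed_csubspace X"
  shows "closed X" "0 \<in> X" "x \<in> X \<Longrightarrow> y \<in> X \<Longrightarrow> x + y \<in> X"
    "x \<in> X \<Longrightarrow> scaleC c x \<in> X" "x \<in> X \<Longrightarrow> y \<in> X \<Longrightarrow> x - y \<in> X" "x \<in> X \<Longrightarrow> scaleR r x \<in> X"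
proof -
  show "closed X" "0 \<in> X" "x \<in> X \<Longrightarrow> y \<in> X \<Longrightarrow> x + y \<in> X" "x \<in> X \<Longrightarrow> scaleC c x \<in> X"
    "x \<in> X \<Longrightarrow> scaleR r x \<in> X"
    using assms by (auto simp: closed_csubspace_def scaleR_scaleC)
  assume "x \<in> X" "y \<in> X"
  then have "x + scaleC (- 1) y \<in> X"
    using assms unfolding closed_csubspace_def by blast
  then show "x - y \<in> X" by (simp add: scaleC_minus_one)
qed

lemma closed_csubspace_UNIV [simp]: "closed_csubspace UNIV"
  by (simp add: closed_csubspace_def)

lemma closed_csubspace_sum:
  assumes "closed_csubspace X" and "\<And>i. i \<in> I \<Longrightarrow> f i \<in> X"
  shows "(\<Sum>i\<in>I. f i) \<in> X"
  using assms(2) by (induction I rule: infinite_finite_induct)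
    (auto simp: closed_csubspaceD[OF assms(1)])

lemma bounded_opsD:
  assumes "R \<in> bounded_ops X Y"
  shows "x \<in> X \<Longrightarrow> R x \<in> Y" "x \<in> X \<Longrightarrow> y \<in> X \<Longrightarrow> R (x + y) = R x + R y"
    "x \<in> X \<Longrightarrow> R (scaleC c x) = scaleC c (R x)"
  using assms by (auto simp: bounded_ops_def)

lemma bounded_ops_bound:
  assumes "R \<in> bounded_ops X Y"
  obtains K where "0 \<le> K" "\<And>x. x \<in> X \<Longrightarrow> norm (R x) \<le> K * norm x"
proof -
  obtain K where K: "\<And>x. x \<in> X \<Longrightarrow> norm (R x) \<le> K * norm x"
    using assms unfolding bounded_ops_def by blast
  have "norm (R x) \<le> max K 0 * norm x" if "x \<in> X" for x
    using K[OF that] by (rule order_trans) (simp add: mult_right_mono)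
  then show ?thesis using that[of "max K 0"] by simp
qed

lemma bounded_ops_restrict:
  assumes "R \<in> bounded_ops X' Y'" and "X \<subseteq> X'" and "\<And>x. x \<in> X \<Longrightarrow> R x \<in> Y"
  shows "R \<in> bounded_ops X Y"
  using assms unfolding bounded_ops_def by blast

lemma bounded_ops_zero:
  assumes "R \<in> bounded_ops X Y" and "0 \<in> X" shows "R 0 = 0"
  using bounded_opsD(3)[OF assms, of 0] by simp

lemma bounded_ops_diff:
  assumes "R \<in> bounded_ops X Y" and "closed_csubspace X" and "x \<in> X" and "y \<in> X"
  shows "R (x - y) = R x - R y"
  using bounded_opsD(2)[OF assms(1) closed_csubspaceD(5)[OF assms(2-4)] assms(4)] by simp

lemma bounded_ops_linear:
  assumes "R \<in> bounded_ops UNIV Y" shows "bounded_linear R"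
proof -
  obtain K where "\<And>x. norm (R x) \<le> K * norm x"
    using bounded_ops_bound[OF assms] by auto
  then show ?thesis
    using assms by (intro bounded_linear_intro[where K = K])
      (auto simp: bounded_ops_def scaleR_scaleC mult.commute)
qed

lemma bounded_ops_sum:
  assumes "R \<in> bounded_ops UNIV Y" shows "R (\<Sum>i\<in>I. f i) = (\<Sum>i\<in>I. R (f i))"
  using linear_sum[OF bounded_linear.linear[OF bounded_ops_linear[OF assms]]] .

lemma bounded_opsI:
  assumes "bounded_linear R" and "\<And>c x. R (scaleC c x) = scaleC c (R x)"
  shows "R \<in> bounded_ops UNIV UNIV"
proof -
  obtain K where "\<And>x. norm (R x) \<le> norm x * K"
    using bounded_linear.bounded[OF assms(1)] by blast
  then show ?thesis
    using assms by (auto simp: bounded_ops_def linear_simps mult.commute intro!: exI[of _ K])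
qed

lemma bounded_ops_compose:
  assumes "R \<in> bounded_ops Y Z" and "R' \<in> bounded_ops X Y"
  shows "(\<lambda>x. R (R' x)) \<in> bounded_ops X Z"
proof -
  obtain K where K: "0 \<le> K" "\<And>y. y \<in> Y \<Longrightarrow> norm (R y) \<le> K * norm y"
    using bounded_ops_bound[OF assms(1)] by blast
  obtain L where L: "0 \<le> L" "\<And>x. x \<in> X \<Longrightarrow> norm (R' x) \<le> L * norm x"
    using bounded_ops_bound[OF assms(2)] by blast
  have "norm (R (R' x)) \<le> (K * L) * norm x" if "x \<in> X" for x
    using order_trans[OF K(2)[OF bounded_opsD(1)[OF assms(2) that]]
        mult_left_mono[OF L(2)[OF that] K(1)]] by (simp add: mult.assoc)
  then show ?thesis
    using assms unfolding bounded_ops_def by (auto intro: exI[of _ "K * L"])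
qed

lemma bounded_ops_add:
  assumes "R \<in> bounded_ops UNIV UNIV" and "R' \<in> bounded_ops UNIV UNIV"
  shows "(\<lambda>x. R x + R' x) \<in> bounded_ops UNIV UNIV"
  using assms by (intro bounded_opsI bounded_linear_add bounded_ops_linear)
    (auto simp: bounded_ops_def scaleC_add_right)

lemma bounded_ops_diff_op:
  assumes "R \<in> bounded_ops UNIV UNIV" and "R' \<in> bounded_ops UNIV UNIV"
  shows "(\<lambda>x. R x - R' x) \<in> bounded_ops UNIV UNIV"
  using assms by (intro bounded_opsI bounded_linear_sub bounded_ops_linear)
    (auto simp: bounded_ops_def scaleC_diff_right)

lemma bounded_ops_sum_op:
  assumes "\<And>i. i \<in> I \<Longrightarrow> R i \<in> bounded_ops UNIV UNIV"
  shows "(\<lambda>x. \<Sum>i\<in>I. R i x) \<in> bounded_ops UNIV UNIV"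
  using assms by (intro bounded_opsI bounded_linear_sum bounded_ops_linear)
    (auto simp: bounded_ops_def scaleC_sum_right)

lemma bounded_ops_id: "(\<lambda>x. x) \<in> bounded_ops UNIV UNIV"
  by (intro bounded_opsI) auto

section \<open>Riesz representation and adjoints\<close>

text \<open>The first-order condition at a minimum: a quadratic in \<open>t\<close> that vanishes at
  0 and is nowhere negative has slope zero there.\<close>

lemma linear_coefficient_zero:
  fixes a b :: real
  assumes "\<And>t. 0 \<le> 2 * t * a + t\<^sup>2 * b" and "0 \<le> b"
  shows "a = 0"
proof (rule ccontr)
  assume "a \<noteq> 0"
  \<comment> \<open>Nearly the minimizer \<open>- a / b\<close>; the added 1 keeps the quotient
    meaningful for \<open>b = 0\<close>.\<close>
  define t where "t = - a / (b + 1)"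
  have a: "a = - (t * (b + 1))" using assms(2) by (simp add: t_def)
  have "2 * t * a + t\<^sup>2 * b = - (t * t) * (b + 2)"
    unfolding a by (simp add: algebra_simps power2_eq_square)
  moreover have "t * t > 0" using a \<open>a \<noteq> 0\<close> by (auto simp: zero_less_mult_iff)
  ultimately have "2 * t * a + t\<^sup>2 * b < 0" using assms(2) by (simp add: mult_neg_pos)
  then show False using assms(1)[of t] by simp
qed

text \<open>The vector \<open>p\<close> is the limit of \<open>D x\<close> along a sequence minimizing \<open>(norm (D x))\<^sup>2 - 2 * \<phi> x\<close>;
  for \<open>D\<close> the identity this is the Riesz representation theorem.\<close>

lemma riesz_closure_range:
  fixes D :: "'a::real_vector \<Rightarrow> 'b::{real_inner, complete_space}" and \<phi> :: "'a \<Rightarrow> real"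
  assumes X: "0 \<in> X" "\<And>x y. x \<in> X \<Longrightarrow> y \<in> X \<Longrightarrow> x + y \<in> X" "\<And>r x. x \<in> X \<Longrightarrow> scaleR r x \<in> X"
    and D: "\<And>x y. x \<in> X \<Longrightarrow> y \<in> X \<Longrightarrow> D (x + y) = D x + D y"
      "\<And>r x. x \<in> X \<Longrightarrow> D (scaleR r x) = scaleR r (D x)"
    and \<phi>: "\<And>x y. x \<in> X \<Longrightarrow> y \<in> X \<Longrightarrow> \<phi> (x + y) = \<phi> x + \<phi> y"
      "\<And>r x. x \<in> X \<Longrightarrow> \<phi> (scaleR r x) = r * \<phi> x"
    and le: "\<And>x. x \<in> X \<Longrightarrow> \<phi> x \<le> K * norm (D x)"
  shows "\<exists>p \<in> closure (D ` X). \<forall>x\<in>X. \<phi> x = inner (D x) p"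
proof -
  define J where "J x = (norm (D x))\<^sup>2 - 2 * \<phi> x" for x
  define m where "m = Inf (J ` X)"
  have lower: "- K\<^sup>2 \<le> J x" if "x \<in> X" for x
    using le[OF that] zero_le_power2[of "norm (D x) - K"]
    unfolding J_def power2_diff by (simp add: mult.commute)
  have m_le: "m \<le> J x" if "x \<in> X" for x
    unfolding m_def using lower that by (intro cInf_lower bdd_belowI2[of _ "- K\<^sup>2"]) auto
  have "\<exists>x\<in>X. J x < m + 1 / Suc n" for n
  proof -
    have "Inf (J ` X) < m + 1 / Suc n" by (simp add: m_def)
    then show ?thesis using cInf_lessD[of "J ` X"] X(1) by blast
  qed
  then obtain s where s: "\<And>n. s n \<in> X" "\<And>n. J (s n) < m + 1 / Suc n" by metis
  have expand: "J (x + scaleR t z) = J x + 2 * t * (inner (D x) (D z) - \<phi> z) + t\<^sup>2 * (norm (D z))\<^sup>2"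
    if "x \<in> X" "z \<in> X" for x z t
  proof -
    have "(norm (D x + scaleR t (D z)))\<^sup>2 = (norm (D x))\<^sup>2 + 2 * t * inner (D x) (D z)
        + t\<^sup>2 * (norm (D z))\<^sup>2"
      unfolding power2_norm_eq_inner
      by (simp add: inner_add_left inner_add_right inner_commute[of "D z" "D x"] power2_eq_square
          algebra_simps)
    then show ?thesis using that by (simp add: J_def D \<phi> X right_diff_distrib)
  qed
  \<comment> \<open>Near-minimizers have close images: the parallelogram law turns the bound
    \<open>m \<le> J\<close> at the midpoint into this estimate.\<close>
  have dist_le: "(norm (D x - D y))\<^sup>2 \<le> 2 * (J x - m) + 2 * (J y - m)" if "x \<in> X" "y \<in> X" for x y
  proof -
    let ?z = "scaleR (1/2) (x + y)"
    have z: "m \<le> J ?z" using that by (intro m_le X)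
    have "J ?z = (norm (D x + D y))\<^sup>2 / 4 - (\<phi> x + \<phi> y)"
      using that by (simp add: J_def D \<phi> X power_mult_distrib power2_eq_square add_divide_distrib)
    moreover have "(norm (D x + D y))\<^sup>2 + (norm (D x - D y))\<^sup>2 = 2 * (norm (D x))\<^sup>2
        + 2 * (norm (D y))\<^sup>2"
      by (simp add: power2_norm_eq_inner algebra_simps inner_commute)
    ultimately show ?thesis using z unfolding J_def by argo
  qed
  have "Cauchy (\<lambda>n. D (s n))"
  proof (rule metric_CauchyI)
    fix e :: real assume "0 < e"
    then obtain M where M: "inverse (real (Suc M)) < e\<^sup>2 / 4"
      using reals_Archimedean[of "e\<^sup>2 / 4"] by auto
    have "dist (D (s i)) (D (s j)) < e" if "M \<le> i" "M \<le> j" for i j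
    proof -
      have "1 / real (Suc i) \<le> inverse (real (Suc M))" "1 / real (Suc j) \<le> inverse (real (Suc M))"
        using that by (auto simp: divide_simps)
      then have "(norm (D (s i) - D (s j)))\<^sup>2 < e\<^sup>2"
        using dist_le[OF s(1) s(1), of i j] s(2)[of i] s(2)[of j] M by argo
      then show ?thesis using \<open>0 < e\<close> by (simp add: dist_norm power2_less_imp_less)
    qed
    then show "\<exists>M. \<forall>i\<ge>M. \<forall>j\<ge>M. dist (D (s i)) (D (s j)) < e" by blast
  qed
  then obtain p where p: "(\<lambda>n. D (s n)) \<longlonglongrightarrow> p"
    using Cauchy_convergent convergent_def by blast
  have "p \<in> closure (D ` X)"
    by (intro closed_sequentially[OF closed_closure _ p])
      (simp add: s(1) subsetD[OF closure_subset])
  moreover have "\<phi> z = inner (D z) p" if "z \<in> X" for z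
  proof -
    \<comment> \<open>Moving from \<open>s n\<close> in the direction \<open>z\<close> lowers
      \<open>J\<close> by less than \<open>1 / Suc n\<close>, because \<open>J (s n)\<close> is that
      close to the infimum; the limit in \<open>n\<close> leaves a nonnegative quadratic in
      \<open>t\<close>.\<close>
    have "0 \<le> 2 * t * (inner p (D z) - \<phi> z) + t\<^sup>2 * (norm (D z))\<^sup>2" for t
    proof (rule LIMSEQ_le_const)
      show "(\<lambda>n. 1 / real (Suc n) + 2 * t * (inner (D (s n)) (D z) - \<phi> z) + t\<^sup>2 * (norm (D z))\<^sup>2)
        \<longlonglongrightarrow> 2 * t * (inner p (D z) - \<phi> z) + t\<^sup>2 * (norm (D z))\<^sup>2"
        by (rule tendsto_eq_intros p LIMSEQ_Suc[OF lim_1_over_n] refl | simp)+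
      have "0 \<le> 1 / real (Suc n) + 2 * t * (inner (D (s n)) (D z) - \<phi> z) + t\<^sup>2 * (norm (D z))\<^sup>2"
          for n
        using m_le[OF X(2)[OF s(1)[of n] X(3)[OF that, of t]]] s(2)[of n]
        unfolding expand[OF s(1) that] by argo
      then show "\<exists>N. \<forall>n\<ge>N. 0 \<le> 1 / real (Suc n) + 2 * t * (inner (D (s n)) (D z) - \<phi> z)
          + t\<^sup>2 * (norm (D z))\<^sup>2"
        by blast
    qed
    then have "inner p (D z) - \<phi> z = 0"
      by (rule linear_coefficient_zero) simp
    then show ?thesis by (simp add: inner_commute)
  qed
  ultimately show ?thesis by blast
qed

text \<open>By the bound, the functional that pairs \<open>M x\<close> with \<open>z\<close> depends
  on \<open>D x\<close> alone and continuously, so it is represented in the closure of the image.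
  The real statement becomes complex by inserting \<open>scaleC \<i> x\<close>, which stays in
  \<open>X\<close>.\<close>

lemma douglas_vector:
  fixes D :: "'a::complex_hilbert \<Rightarrow> 'b::complex_hilbert" and M :: "'a \<Rightarrow> 'c::complex_hilbert"
  assumes X: "closed_csubspace X" and D: "D \<in> bounded_ops X Y" and M: "M \<in> bounded_ops X Z"
    and le: "\<And>x. x \<in> X \<Longrightarrow> norm (M x) \<le> K * norm (D x)"
  shows "\<exists>p \<in> closure (D ` X). \<forall>x\<in>X. cinner (M x) z = cinner (D x) p"
proof -
  have "\<exists>p \<in> closure (D ` X). \<forall>x\<in>X. inner (M x) z = inner (D x) p"
  proof (rule riesz_closure_range)
    show "inner (M x) z \<le> (K * norm z) * norm (D x)" if "x \<in> X" for x
      using norm_cauchy_schwarz[of "M x" z] mult_right_mono[OF le[OF that] norm_ge_zero[of z]]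
      by (simp add: mult_ac)
  qed (use D M in \<open>auto simp: closed_csubspaceD[OF X] scaleR_scaleC bounded_opsD
        inner_add_left inner_eq_Re_cinner cinner_add_left cinner_scaleC_left\<close>)
  then obtain p where p: "p \<in> closure (D ` X)" "\<forall>x\<in>X. inner (M x) z = inner (D x) p"
    by blast
  have "cinner (M x) z = cinner (D x) p" if "x \<in> X" for x
  proof (rule cinner_eqI_inner)
    have "scaleC \<i> x \<in> X" using X that by (rule closed_csubspaceD)
    then show "inner (scaleC \<i> (M x)) z = inner (scaleC \<i> (D x)) p"
      using p(2) that D M bounded_opsD(3) by metis
  qed (use p(2) that in simp)
  then show ?thesis using p(1) by blast
qed

lemma adjoint_on_eqI:
  assumes X: "closed_csubspace X" and "y \<in> Y" and "x \<in> X"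
    and "\<And>z. z \<in> X \<Longrightarrow> cinner (R z) y = cinner z x"
  shows "adjoint_on X Y R y = x"
proof -
  have "x' = x" if "x' \<in> X" "\<forall>z\<in>X. cinner (R z) y = cinner z x'" for x'
  proof -
    have "cinner (x' - x) x' = cinner (x' - x) x"
      using that assms closed_csubspaceD(5)[OF X] by metis
    then have "cinner (x' - x) (x' - x) = 0" by (simp add: cinner_diff_right)
    then show ?thesis by (simp add: cinner_self)
  qed
  then have "(THE x. x \<in> X \<and> (\<forall>z\<in>X. cinner (R z) y = cinner z x)) = x"
    using assms by (intro the_equality) auto
  then show ?thesis using assms(2) by (simp add: adjoint_on_def)
qed

text \<open>\<open>adjoint_on\<close> is a definite description, and existence is secured here:
  \<open>douglas_vector\<close> with the identity for \<open>D\<close> is the Riesz theorem on the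
  closed subspace \<open>X\<close>.\<close>

lemma adjoint_on_correct:
  assumes X: "closed_csubspace X" and R: "R \<in> bounded_ops X Y" and y: "y \<in> Y"
  shows "adjoint_on X Y R y \<in> X" and "z \<in> X \<Longrightarrow> cinner (R z) y = cinner z (adjoint_on X Y R y)"
proof -
  obtain K where K: "\<And>x. x \<in> X \<Longrightarrow> norm (R x) \<le> K * norm x"
    using bounded_ops_bound[OF R] by blast
  have "(\<lambda>x. x) \<in> bounded_ops X UNIV"
    by (auto simp: bounded_ops_def intro!: exI[of _ 1])
  then have "\<exists>p \<in> closure ((\<lambda>x. x) ` X). \<forall>x\<in>X. cinner (R x) y = cinner x p"
    by (rule douglas_vector[OF X _ R K])
  then obtain p where p: "p \<in> X" "\<forall>x\<in>X. cinner (R x) y = cinner x p"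
    using closed_csubspaceD(1)[OF X] by auto
  moreover have "adjoint_on X Y R y = p"
    using p by (intro adjoint_on_eqI[OF X y]) auto
  ultimately show "adjoint_on X Y R y \<in> X" "z \<in> X \<Longrightarrow> cinner (R z) y = cinner z (adjoint_on X Y R y)"
    by auto
qed

abbreviation adj :: "('a::complex_hilbert \<Rightarrow> 'b::complex_hilbert) \<Rightarrow> 'b \<Rightarrow> 'a" where
  "adj \<equiv> adjoint_on UNIV UNIV"

lemma cinner_adj:
  "R \<in> bounded_ops UNIV UNIV \<Longrightarrow> cinner x (adj R y) = cinner (R x) y"
  using adjoint_on_correct(2)[of UNIV R UNIV] by simp

lemma cinner_adj':
  "R \<in> bounded_ops UNIV UNIV \<Longrightarrow> cinner (adj R y) x = cinner y (R x)"
  using cinner_adj[of R x y] by (metis cinner_commute)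

lemma adj_eqI:
  assumes "\<And>z. cinner (R z) y = cinner z x" shows "adj R y = x"
  using assms by (intro adjoint_on_eqI) auto

text \<open>Test the pairing at \<open>x = R' y\<close>. Formulated for a pair, it bounds
  \<open>adj T\<close> by \<open>T\<close> as well as \<open>T\<close> by
  \<open>adj T\<close>.\<close>

lemma norm_le_if_adjoint_pair:
  fixes R :: "'a::complex_hilbert \<Rightarrow> 'b::complex_hilbert"
  assumes "\<And>x y. cinner (R x) y = cinner x (R' y)" and "\<And>x. norm (R x) \<le> K * norm x" and "0 \<le> K"
  shows "norm (R' y) \<le> K * norm y"
proof -
  have "(norm (R' y))\<^sup>2 = inner (R (R' y)) y"
    using assms(1)[of "R' y" y] by (simp add: inner_eq_Re_cinner power2_norm_eq_inner)
  also have "\<dots> \<le> (K * norm (R' y)) * norm y"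
    by (rule order_trans[OF norm_cauchy_schwarz mult_right_mono[OF assms(2)]]) simp
  finally have "norm (R' y) * norm (R' y) \<le> norm (R' y) * (K * norm y)"
    by (simp add: power2_eq_square mult_ac)
  then show ?thesis
    using assms(3) by (cases "R' y = 0") auto
qed

lemma adj_bounded_ops:
  assumes R: "R \<in> bounded_ops UNIV UNIV" shows "adj R \<in> bounded_ops UNIV UNIV"
proof -
  obtain K where K: "0 \<le> K" "\<And>x. norm (R x) \<le> K * norm x"
    using bounded_ops_bound[OF R] by auto
  have "norm (adj R y) \<le> K * norm y" for y
    using K by (intro norm_le_if_adjoint_pair[where R = R]) (auto simp: cinner_adj[OF R])
  moreover have "adj R (x + y) = adj R x + adj R y" "adj R (scaleC c x) = scaleC c (adj R x)"
      for x y c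
    by (auto intro!: adj_eqI simp: cinner_add_right cinner_adj[OF R] cinner_scaleC_right)
  ultimately show ?thesis unfolding bounded_ops_def by auto
qed

lemma closed_csubspace_closure_range:
  assumes D: "D \<in> bounded_ops UNIV UNIV" shows "closed_csubspace (closure (range D))"
  unfolding closed_csubspace_def
proof (intro conjI ballI allI)
  show "0 \<in> closure (range D)"
    using closure_subset bounded_ops_zero[OF D] by (metis UNIV_I rangeI subsetD)
  fix x assume "x \<in> closure (range D)"
  then obtain s where s: "\<And>n. s n \<in> range D" "s \<longlonglongrightarrow> x"
    by (auto simp: closure_sequential)
  show "scaleC c x \<in> closure (range D)" for c
  proof (rule closed_sequentially[OF closed_closure])
    show "scaleC c (s n) \<in> closure (range D)" for n
    proof -
      obtain a where "s n = D a" using s(1)[of n] by blast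
      then have "scaleC c (s n) = D (scaleC c a)" using bounded_opsD(3)[OF D UNIV_I] by simp
      then show ?thesis by (simp add: subsetD[OF closure_subset])
    qed
    have "bounded_linear (scaleC c :: 'b \<Rightarrow> 'b)"
      by (rule bounded_linear_intro[where K = "cmod c"])
        (auto simp: scaleC_add_right scaleR_scaleC scaleC_scaleC norm_scaleC mult.commute)
    then show "(\<lambda>n. scaleC c (s n)) \<longlonglongrightarrow> scaleC c x"
      using s(2) by (rule bounded_linear.tendsto)
  qed
  fix y assume "y \<in> closure (range D)"
  then obtain t where t: "\<And>n. t n \<in> range D" "t \<longlonglongrightarrow> y"
    by (auto simp: closure_sequential)
  show "x + y \<in> closure (range D)"
  proof (rule closed_sequentially[OF closed_closure _ tendsto_add[OF s(2) t(2)]])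
    show "s n + t n \<in> closure (range D)" for n
    proof -
      obtain a b where "s n = D a" "t n = D b" using s(1)[of n] t(1)[of n] by blast
      then have "s n + t n = D (a + b)" using bounded_opsD(2)[OF D UNIV_I UNIV_I] by simp
      then show ?thesis by (simp add: subsetD[OF closure_subset])
    qed
  qed
qed auto

lemma closure_range_orthogonal:
  fixes D :: "'a \<Rightarrow> 'b::complex_hilbert"
  assumes "\<And>x. cinner (D x) r = 0" and "y \<in> closure (range D)"
  shows "inner y r = 0"
proof -
  have "closure (range D) \<subseteq> {y. inner y r = 0}"
  proof (rule closure_minimal)
    show "closed {y. inner y r = 0}"
      unfolding inner_commute[of _ r] by (rule closed_hyperplane)
  qed (auto simp: inner_eq_Re_cinner assms(1))
  then show ?thesis using assms(2) by blast
qed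

text \<open>Douglas factorization of \<open>M\<close> through \<open>D\<close>. Instead of extending
  the contraction that takes \<open>D x\<close> to \<open>M x\<close>, its adjoint \<open>Z\<close>
  is built pointwise from Riesz vectors. Lying in the closure of the range makes \<open>Z z\<close>
  unique, and uniqueness gives linearity.\<close>

lemma douglas:
  fixes D :: "'a::complex_hilbert \<Rightarrow> 'b::complex_hilbert" and M :: "'a \<Rightarrow> 'c::complex_hilbert"
  assumes D: "D \<in> bounded_ops UNIV UNIV" and M: "M \<in> bounded_ops UNIV UNIV"
    and le: "\<And>x. norm (M x) \<le> norm (D x)"
  obtains Z where "Z \<in> bounded_ops UNIV UNIV" "\<And>z. Z z \<in> closure (range D)"
    "\<And>x. adj Z (D x) = M x"
proof -
  have "\<exists>p \<in> closure (range D). \<forall>x. cinner (M x) z = cinner (D x) p" for z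
    using douglas_vector[of UNIV D UNIV M UNIV 1] D M le by simp
  then obtain Z where Z: "\<And>z. Z z \<in> closure (range D)" "\<And>x z. cinner (M x) z = cinner (D x) (Z z)"
    by metis
  let ?C = "closure (range D)"
  note C = closed_csubspace_closure_range[OF D]
  have uniq: "p = Z z" if "p \<in> ?C" "\<And>x. cinner (D x) p = cinner (M x) z" for p z
    using closure_range_orthogonal[of D "p - Z z" "p - Z z"] that Z closed_csubspaceD(5)[OF C]
    by (simp add: cinner_diff_right)
  have "Z (x + y) = Z x + Z y" for x y
    by (rule uniq[symmetric]) (simp_all add: Z(1) closed_csubspaceD(3,4)[OF C] cinner_add_right Z(2)[symmetric])
  moreover have "Z (scaleC c x) = scaleC c (Z x)" for x c
    by (rule uniq[symmetric]) (simp_all add: Z(1) closed_csubspaceD(3,4)[OF C] cinner_scaleC_right Z(2)[symmetric])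
  moreover have "norm (Z z) \<le> 1 * norm z" for z
  proof -
    \<comment> \<open>The estimate passes from the range of \<open>D\<close> to its closure and is
      then used at \<open>y = Z z\<close>.\<close>
    have "?C \<subseteq> {y. inner y (Z z) \<le> norm y * norm z}"
    proof (rule closure_minimal)
      have "inner (D x) (Z z) = inner (M x) z" for x
        by (simp add: inner_eq_Re_cinner Z)
      also have "inner (M x) z \<le> norm (D x) * norm z" for x
        using norm_cauchy_schwarz[of "M x" z] mult_right_mono[OF le[of x] norm_ge_zero[of z]]
        by simp
      finally show "range D \<subseteq> {y. inner y (Z z) \<le> norm y * norm z}" by auto
      show "closed {y. inner y (Z z) \<le> norm y * norm z}"
        by (intro closed_Collect_le continuous_intros)
    qed
    then have "norm (Z z) * norm (Z z) \<le> norm (Z z) * norm z"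
      using Z(1)[of z] by (auto simp: power2_norm_eq_inner[symmetric] power2_eq_square)
    then show ?thesis by (cases "Z z = 0") auto
  qed
  ultimately have "Z \<in> bounded_ops UNIV UNIV"
    unfolding bounded_ops_def by blast
  moreover have "adj Z (D x) = M x" for x
  proof (rule adj_eqI)
    show "cinner (Z z) (D x) = cinner z (M x)" for z
      using Z(2)[of x z] by (metis cinner_commute)
  qed
  ultimately show ?thesis using that Z(1) by blast
qed

section \<open>Square roots of defect operators\<close>

text \<open>\<open>sqrt_iter X n\<close> is a polynomial in \<open>X\<close> with nonnegative coefficients, and so is the difference
  of two consecutive ones; their values at \<open>1\<close> are \<open>sqrt_iter_bound n\<close>. The limit \<open>Y\<close> of the
  iteration satisfies \<open>2 Y = X + Y\<^sup>2\<close>, that is, \<open>(1 - Y)\<^sup>2 = 1 - X\<close>.\<close>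

primrec sqrt_iter :: "('a::real_vector \<Rightarrow> 'a) \<Rightarrow> nat \<Rightarrow> 'a \<Rightarrow> 'a" where
  "sqrt_iter X 0 = (\<lambda>x. 0)"
| "sqrt_iter X (Suc n) = (\<lambda>x. scaleR (1 / 2) (X x + sqrt_iter X n (sqrt_iter X n x)))"

primrec sqrt_iter_bound :: "nat \<Rightarrow> real" where
  "sqrt_iter_bound 0 = 0"
| "sqrt_iter_bound (Suc n) = (1 + (sqrt_iter_bound n)\<^sup>2) / 2"

lemma sqrt_iter_bound_range: "0 \<le> sqrt_iter_bound n \<and> sqrt_iter_bound n \<le> 1"
  by (induction n) (auto simp: power_le_one)

lemma sqrt_iter_bound_mono: "mono sqrt_iter_bound"
proof (rule mono_iff_le_Suc[THEN iffD2], rule allI)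
  fix n
  have "2 * sqrt_iter_bound (Suc n) - 2 * sqrt_iter_bound n = (1 - sqrt_iter_bound n)\<^sup>2"
    by (simp add: power2_eq_square algebra_simps)
  then show "sqrt_iter_bound n \<le> sqrt_iter_bound (Suc n)"
    using zero_le_power2[of "1 - sqrt_iter_bound n"] by linarith
qed

lemma sqrt_iter_bounded_ops:
  assumes "X \<in> bounded_ops UNIV UNIV"
  shows "sqrt_iter X n \<in> bounded_ops UNIV UNIV"
proof (induction n)
  case 0
  show ?case by (auto simp: bounded_ops_def intro: exI[of _ 0])
next
  case (Suc n)
  have "(\<lambda>x. scaleC (of_real (1 / 2)) (X x + sqrt_iter X n (sqrt_iter X n x)))
      \<in> bounded_ops UNIV UNIV"
  proof (rule bounded_ops_compose[where R = "scaleC (of_real (1 / 2))"])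
    show "scaleC (of_real (1 / 2)) \<in> bounded_ops UNIV UNIV"
      by (auto simp: bounded_ops_def scaleC_add_right scaleC_scaleC norm_scaleC mult.commute
          intro!: exI[of _ "1 / 2"])
  qed (intro bounded_ops_add assms bounded_ops_compose[OF Suc Suc])
  then show ?case by (simp add: scaleR_scaleC)
qed

lemma sqrt_iter_norm_le:
  assumes "\<And>x. norm (X x) \<le> norm x"
  shows "norm (sqrt_iter X n x) \<le> sqrt_iter_bound n * norm x"
proof (induction n arbitrary: x)
  case (Suc n)
  have "norm (sqrt_iter X n (sqrt_iter X n x)) \<le> sqrt_iter_bound n * norm (sqrt_iter X n x)"
    by (rule Suc)
  also have "\<dots> \<le> sqrt_iter_bound n * (sqrt_iter_bound n * norm x)"
    using Suc sqrt_iter_bound_range by (intro mult_left_mono) auto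
  finally have "norm (X x + sqrt_iter X n (sqrt_iter X n x))
      \<le> norm x + sqrt_iter_bound n * (sqrt_iter_bound n * norm x)"
    by (intro norm_triangle_mono assms)
  then show ?case
    unfolding sqrt_iter.simps sqrt_iter_bound.simps norm_scaleR
    by (simp add: power2_eq_square algebra_simps)
qed simp

text \<open>For consecutive iterates, \<open>Z Z - Y Y = (Z - Y) Z + Y (Z - Y)\<close>. The scalar
  bounds satisfy the same recursion, so they dominate term by term.\<close>

lemma sqrt_iter_step_le:
  fixes X :: "'a::complex_hilbert \<Rightarrow> 'a"
  assumes X: "X \<in> bounded_ops UNIV UNIV" "\<And>x. norm (X x) \<le> norm x"
  shows "norm (sqrt_iter X (Suc n) x - sqrt_iter X n x)
    \<le> (sqrt_iter_bound (Suc n) - sqrt_iter_bound n) * norm x"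
proof (induction n arbitrary: x)
  case 0
  then show ?case using X(2)[of x] by simp
next
  case (Suc n)
  let ?Y = "sqrt_iter X n" and ?Z = "sqrt_iter X (Suc n)"
  let ?y = "sqrt_iter_bound n" and ?z = "sqrt_iter_bound (Suc n)"
  have diff: "sqrt_iter X (Suc (Suc n)) x - ?Z x = scaleR (1 / 2) ((?Z (?Z x) - ?Y (?Z x))
      + ?Y (?Z x - ?Y x))"
    unfolding bounded_ops_diff[OF
        sqrt_iter_bounded_ops[OF X(1)] closed_csubspace_UNIV UNIV_I UNIV_I]
    unfolding sqrt_iter.simps(2)[of X "Suc n"] by (simp add: algebra_simps)
  have yz: "0 \<le> ?z - ?y" "0 \<le> ?y"
    using monoD[OF sqrt_iter_bound_mono, of n "Suc n"] sqrt_iter_bound_range[of n] by auto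
  have "norm (?Z (?Z x) - ?Y (?Z x)) \<le> (?z - ?y) * norm (?Z x)"
    by (rule Suc)
  also have "\<dots> \<le> (?z - ?y) * (?z * norm x)"
    using yz by (intro mult_left_mono sqrt_iter_norm_le X) auto
  finally have a: "norm (?Z (?Z x) - ?Y (?Z x)) \<le> (?z - ?y) * (?z * norm x)" .
  have "norm (?Y (?Z x - ?Y x)) \<le> ?y * norm (?Z x - ?Y x)"
    by (rule sqrt_iter_norm_le[OF X(2)])
  also have "\<dots> \<le> ?y * ((?z - ?y) * norm x)"
    using yz by (intro mult_left_mono Suc) auto
  finally have b: "norm (?Y (?Z x - ?Y x)) \<le> ?y * ((?z - ?y) * norm x)" .
  have "norm (sqrt_iter X (Suc (Suc n)) x - ?Z x)
      \<le> ((?z - ?y) * (?z * norm x) + ?y * ((?z - ?y) * norm x)) / 2"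
    unfolding diff using norm_triangle_mono[OF a b] by simp
  also have "\<dots> = (sqrt_iter_bound (Suc (Suc n)) - ?z) * norm x"
    unfolding sqrt_iter_bound.simps(2)[of "Suc n"] sqrt_iter_bound.simps(2)[of n]
    by (simp add: field_simps power2_eq_square)
  finally show ?case .
qed

lemma sqrt_iter_self_adjoint:
  fixes X :: "'a::real_inner \<Rightarrow> 'a"
  assumes "\<And>x y. inner (X x) y = inner x (X y)"
  shows "inner (sqrt_iter X n x) y = inner x (sqrt_iter X n y)"
  by (induction n arbitrary: x y) (auto simp: inner_add_left inner_add_right assms)

text \<open>The increments of the bounded increasing sequence \<open>sqrt_iter_bound\<close>
  dominate those of the iterates, which therefore converge pointwise; \<open>R\<close> is the
  identity minus the limit.\<close>

lemma obtain_sqrt_defect: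
  fixes X :: "'a::complex_hilbert \<Rightarrow> 'a"
  assumes X: "X \<in> bounded_ops UNIV UNIV" "\<And>x. norm (X x) \<le> norm x"
    and adj: "\<And>x y. cinner (X x) y = cinner x (X y)"
  obtains R where "R \<in> bounded_ops UNIV UNIV" "\<And>x y. cinner (R x) y = cinner x (R y)"
    "\<And>x. R (R x) = x - X x"
proof -
  let ?Y = "sqrt_iter X" and ?y = "sqrt_iter_bound"
  note ops = sqrt_iter_bounded_ops[OF X(1)]
  have le: "norm (?Y (n + k) x - ?Y n x) \<le> (?y (n + k) - ?y n) * norm x" for n k x
  proof (induction k)
    case (Suc k)
    have "norm (?Y (n + Suc k) x - ?Y n x) \<le> norm (?Y (Suc (n + k)) x - ?Y (n + k) x) + norm (?Y (n
        + k) x - ?Y n x)"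
      using norm_triangle_ineq[of "?Y (Suc (n + k)) x - ?Y (n + k) x" "?Y (n + k) x - ?Y n x"]
      by simp
    also have "\<dots> \<le> (?y (Suc (n + k)) - ?y (n + k)) * norm x + (?y (n + k) - ?y n) * norm x"
      by (intro add_mono sqrt_iter_step_le X Suc)
    finally show ?case by (simp add: algebra_simps)
  qed simp
  have "Bseq ?y"
    using sqrt_iter_bound_range by (intro BseqI'[where K = 1]) simp
  then have "Cauchy ?y"
    by (intro convergent_Cauchy Bseq_monoseq_convergent incseq_imp_monoseq sqrt_iter_bound_mono)
  have "Cauchy (\<lambda>n. ?Y n x)" for x
  proof (rule metric_CauchyI)
    fix e :: real assume e: "0 < e"
    obtain M where M: "\<And>i j. M \<le> i \<Longrightarrow> M \<le> j \<Longrightarrow> dist (?y i) (?y j) < e / (norm x + 1)"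
      using \<open>Cauchy ?y\<close> e unfolding Cauchy_def
      by (metis add_nonneg_pos divide_pos_pos norm_ge_zero zero_less_one)
    have *: "dist (?Y j x) (?Y i x) < e" if ij: "M \<le> i" "i \<le> j" for i j
    proof -
      have "dist (?Y j x) (?Y i x) \<le> (?y j - ?y i) * norm x"
        using le[where n=i and k="j - i" and x=x] ij by (simp add: dist_norm)
      also have "\<dots> \<le> (e / (norm x + 1)) * norm x"
        using M[of j i] ij by (intro mult_right_mono) (auto simp: dist_real_def)
      also have "\<dots> < e"
        using e by (simp add: field_simps add_pos_nonneg)
      finally show ?thesis .
    qed
    then show "\<exists>M. \<forall>i\<ge>M. \<forall>j\<ge>M. dist (?Y i x) (?Y j x) < e"
      by (metis dist_commute nle_le)
  qed
  then have "\<forall>x. \<exists>l. (\<lambda>n. ?Y n x) \<longlonglongrightarrow> l"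
    using Cauchy_convergent convergent_def by blast
  then obtain Z where Z: "\<And>x. (\<lambda>n. ?Y n x) \<longlonglongrightarrow> Z x" by metis
  have Y1: "norm (?Y n x) \<le> norm x" for n x
    using order_trans[OF sqrt_iter_norm_le[OF X(2)]
        mult_right_mono[OF conjunct2[OF sqrt_iter_bound_range]]]
    by simp
  have "Z (x + y) = Z x + Z y" for x y
    using LIMSEQ_unique[OF Z[of "x + y"]] tendsto_add[OF Z Z] bounded_opsD(2)[OF ops] by auto
  moreover have "Z (scaleC c x) = scaleC c (Z x)" for c x
  proof -
    have "bounded_linear (scaleC c :: 'a \<Rightarrow> 'a)"
      by (rule bounded_linear_intro[where K = "cmod c"])
        (auto simp: scaleC_add_right scaleR_scaleC scaleC_scaleC norm_scaleC mult.commute)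
    then show ?thesis
      using LIMSEQ_unique[OF Z[of
          "scaleC c x"]] bounded_linear.tendsto[OF _ Z] bounded_opsD(3)[OF ops]
      by auto
  qed
  moreover have "norm (Z x) \<le> 1 * norm x" for x
    using Y1 by (intro LIMSEQ_le_const2[OF tendsto_norm[OF Z]]) auto
  ultimately have Z_ops: "Z \<in> bounded_ops UNIV UNIV"
    unfolding bounded_ops_def by blast
  have Z_square: "Z x = scaleR (1 / 2) (X x + Z (Z x))" for x
  proof -
    \<comment> \<open>To pass to the limit in the square, \<open>?Y n (?Y n x)\<close> is split as
      \<open>?Y n (?Y n x - Z x) + ?Y n (Z x)\<close>; the first term vanishes since all iterates
      are contractions.\<close>
    have "(\<lambda>n. ?Y n (?Y n x - Z x)) \<longlonglongrightarrow> 0"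
    proof (rule Lim_null_comparison)
      show "(\<lambda>n. norm (?Y n x - Z x)) \<longlonglongrightarrow> 0"
        using tendsto_diff[OF Z tendsto_const] by (intro tendsto_norm_zero) (metis diff_self)
    qed (simp add: Y1)
    from tendsto_add[OF this Z[of "Z x"]] have "(\<lambda>n. ?Y n (?Y n x)) \<longlonglongrightarrow> Z (Z x)"
      using bounded_ops_diff[OF ops closed_csubspace_UNIV UNIV_I UNIV_I] by simp
    then have "(\<lambda>n. ?Y (Suc n) x) \<longlonglongrightarrow> scaleR (1 / 2) (X x + Z (Z x))"
      by (simp add: tendsto_intros)
    then show ?thesis
      using LIMSEQ_unique[OF LIMSEQ_Suc[OF Z]] by blast
  qed
  have Z_inner: "inner (Z x) y = inner x (Z y)" for x y
  proof -
    have "inner (X x) y = inner x (X y)" for x y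
      using adj by (simp add: inner_eq_Re_cinner)
    from sqrt_iter_self_adjoint[of X, OF this]
    have "(\<lambda>n. inner (?Y n x) y) \<longlonglongrightarrow> inner x (Z y)"
      using tendsto_inner[OF tendsto_const Z] by simp
    then show ?thesis
      using LIMSEQ_unique tendsto_inner[OF Z tendsto_const] by blast
  qed
  have Z_adj: "cinner (Z x) y = cinner x (Z y)" for x y
    using bounded_opsD(3)[OF Z_ops] Z_inner by (intro cinner_eqI_inner) (auto
        simp flip: bounded_opsD(3)[OF Z_ops])
  show ?thesis
  proof (rule that[of "\<lambda>x. x - Z x"])
    show "(\<lambda>x. x - Z x) \<in> bounded_ops UNIV UNIV"
      by (intro bounded_ops_diff_op bounded_ops_id Z_ops)
    show "cinner (x - Z x) y = cinner x (y - Z y)" for x y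
      by (simp add: cinner_diff_left cinner_diff_right Z_adj)
    have "scaleR 2 (Z x) = X x + Z (Z x)" for x
      using arg_cong[OF Z_square[of x], of "scaleR 2"] by simp
    then show "x - Z x - Z (x - Z x) = x - X x" for x
      by (simp add: bounded_ops_diff[OF Z_ops] scaleR_2 algebra_simps)
  qed
qed

section \<open>Operators on word-indexed direct sums\<close>

lemma l2_eqI: "(\<And>i. l2_nth f i = l2_nth g i) \<Longrightarrow> f = g"
  by (simp add: l2_nth_inject[symmetric] ext)

lemmas l2_nth_simps [simp] = plus_l2sum.rep_eq zero_l2sum.rep_eq scaleC_l2sum.rep_eq
  uminus_l2sum.rep_eq minus_l2sum.rep_eq scaleR_l2sum.rep_eq

lemma l2_nth_sum [simp]: "l2_nth (\<Sum>i\<in>I. f i) w = (\<Sum>i\<in>I. l2_nth (f i) w)"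
  by (induction I rule: infinite_finite_induct) auto

lemmas fock_nth_simps [simp] = proj_level.rep_eq strip.rep_eq

lemma l2_nth_prepend [simp]:
  "l2_nth (prepend j f) [] = 0"
  "l2_nth (prepend j f) (k # v) = (if k = j then l2_nth f v else 0)"
  by (simp_all add: prepend.rep_eq)

lemma l2_norm_le:
  assumes "0 \<le> c" and "\<And>i. norm (l2_nth f i) \<le> c * norm (l2_nth g i)"
  shows "norm f \<le> c * norm g"
proof -
  have "(\<Sum>i\<in>S. (norm (l2_nth f i))\<^sup>2) \<le> (c * norm g)\<^sup>2" if "finite S" for S
  proof -
    have "(\<Sum>i\<in>S. (norm (l2_nth f i))\<^sup>2) \<le> (\<Sum>i\<in>S. c\<^sup>2 * (norm (l2_nth g i))\<^sup>2)"
      using power_mono[OF assms(2) norm_ge_zero, where n = 2]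
          by (intro sum_mono) (simp add: power_mult_distrib)
    also have "\<dots> \<le> c\<^sup>2 * (norm g)\<^sup>2"
      unfolding sum_distrib_left[symmetric] by (intro mult_left_mono sum_norm_nth_le that) simp
    finally show ?thesis by (simp add: power_mult_distrib)
  qed
  then show ?thesis
    using l2sum_of_bounded_sums(2)[of "c * norm g" "l2_nth f"] assms(1)
        by (simp add: l2_nth_inverse)
qed

lift_definition l2_single :: "'i \<Rightarrow> 'e::complex_hilbert \<Rightarrow> ('i, 'e) l2sum"
  is "\<lambda>w e v. if v = w then e else 0"
proof -
  fix w :: 'i and e :: 'e
  have "(\<lambda>v. (norm (if v = w then e else 0))\<^sup>2) summable_on {w}" by (rule summable_on_finite) simp
  then show "square_summable (\<lambda>v. if v = w then e else 0)"
    unfolding square_summable_def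
    by (rule summable_on_cong_neutral[THEN iffD1, rotated -1]) auto
qed

lemmas l2_nth_single [simp] = l2_single.rep_eq

lemma cinner_l2_single: "cinner (l2_single w e) g = cinner e (l2_nth g w)"
proof -
  have "cinner (l2_single w e) g = (\<Sum>\<^sub>\<infinity>v\<in>{w}. cinner (l2_nth (l2_single w e) v) (l2_nth g v))"
    unfolding cinner_l2sum.rep_eq by (rule infsum_cong_neutral) auto
  then show ?thesis by simp
qed

lemma cinner_l2_single_right: "cinner g (l2_single w e) = cinner (l2_nth g w) e"
  using cinner_l2_single[of w e g] by (metis cinner_commute)

lemma l2_single_bounded_ops:
  fixes w :: 'i shows "(l2_single w :: 'b::complex_hilbert \<Rightarrow> _) \<in> bounded_ops UNIV UNIV"
proof -
  have "cinner (l2_single w e) (l2_single w e) = cinner e e" for e :: 'b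
    by (simp add: cinner_l2_single)
  then have "norm (l2_single w e) = norm e" for e :: 'b
    by (rule norm_eq_if_cinner_self_eq)
  then show ?thesis
    by (auto simp: bounded_ops_def intro!: l2_eqI exI[of _ 1])
qed

lemma l2_nth_bounded_ops: "(\<lambda>f. l2_nth f w) \<in> bounded_ops UNIV UNIV"
  by (auto simp: bounded_ops_def norm_nth_le intro!: exI[of _ 1])

lemma cinner_prepend:
  fixes f g :: "('n::finite, 'e::complex_hilbert) fock"
  shows "cinner (prepend j f) g = cinner f (strip j g)"
proof -
  have "cinner (prepend j f) g = (\<Sum>\<^sub>\<infinity>w\<in>range (Cons j). cinner (l2_nth f (tl w)) (l2_nth g w))"
    unfolding cinner_l2sum.rep_eq prepend.rep_eq
    by (rule infsum_cong_neutral) (auto split: list.splits)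
  also have "\<dots> = cinner f (strip j g)"
    by (subst infsum_reindex) (auto simp: o_def cinner_l2sum.rep_eq)
  finally show ?thesis .
qed

lemma cinner_strip: "cinner (strip j f) g = cinner f (prepend j g)"
  using cinner_prepend[of j g f] by (metis cinner_commute)

lemma strip_prepend: "strip j (prepend k f) = (if j = k then f else 0)"
  by (auto intro: l2_eqI)

lemma fock_decompose:
  "f = l2_single [] (l2_nth f []) + (\<Sum>j\<in>UNIV. prepend j (strip j f))"
proof (rule l2_eqI)
  show "l2_nth f w = l2_nth (l2_single [] (l2_nth f []) + (\<Sum>j\<in>UNIV. prepend j (strip j f))) w" for w
    by (cases w) auto
qed

lemma fock_norm_decompose:
  "(norm f)\<^sup>2 = (norm (l2_nth f []))\<^sup>2 + (\<Sum>j\<in>UNIV. (norm (strip j f))\<^sup>2)"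
proof -
  have "cinner f f = cinner (l2_single [] (l2_nth f []) + (\<Sum>j\<in>UNIV. prepend j (strip j f))) f"
    using fock_decompose[of f] by simp
  then have "inner f f = inner (l2_nth f []) (l2_nth f [])
      + (\<Sum>j\<in>UNIV. inner (strip j f) (strip j f))"
    by (simp add: inner_eq_Re_cinner cinner_add_left cinner_sum_left cinner_l2_single cinner_prepend)
  then show ?thesis by (simp add: power2_norm_eq_inner)
qed

lemma norm_strip_le: "(norm (l2_nth f []))\<^sup>2 + (norm (strip j f))\<^sup>2 \<le> (norm f)\<^sup>2"
  unfolding fock_norm_decompose[of f]
  using sum_nonneg_leq_bound[of UNIV "\<lambda>j. (norm (strip j f))\<^sup>2"] by simp

lemma norm_prepend: "norm (prepend j f) = norm f"
  by (rule norm_eq_if_cinner_self_eq) (simp add: cinner_prepend strip_prepend)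

lemma prepend_bounded_ops: "prepend j \<in> bounded_ops UNIV UNIV"
  by (auto simp: bounded_ops_def norm_prepend prepend.rep_eq
      intro!: l2_eqI exI[of _ 1] split: list.splits)

lemma strip_bounded_ops: "strip j \<in> bounded_ops UNIV UNIV"
proof -
  have "norm (strip j f) \<le> norm f" for f :: "('a, 'b) fock"
  proof (rule power2_le_imp_le)
    show "(norm (strip j f))\<^sup>2 \<le> (norm f)\<^sup>2"
      using norm_strip_le[of f j] zero_le_power2[of "norm (l2_nth f [])"] by linarith
  qed simp
  then show ?thesis
    by (auto simp: bounded_ops_def intro!: l2_eqI exI[of _ 1])
qed

section \<open>Operations on the last letter, and coordinatewise operators\<close>

definition rstrip :: "'n::finite \<Rightarrow> ('n, 'e::complex_hilbert) fock \<Rightarrow> ('n, 'e) fock" where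
  "rstrip j f = Abs_l2sum (\<lambda>w. l2_nth f (w @ [j]))"

lemma rstrip_bounds:
  "l2_nth (rstrip j f) w = l2_nth f (w @ [j])" "norm (rstrip j f) \<le> norm f"
proof -
  have sums: "(\<Sum>w\<in>S. (norm (l2_nth f (w @ [j])))\<^sup>2) \<le> (norm f)\<^sup>2" if "finite S" for S
  proof -
    have "(\<Sum>w\<in>S. (norm (l2_nth f (w @ [j])))\<^sup>2) = (\<Sum>w\<in>(\<lambda>w. w @ [j]) ` S. (norm (l2_nth f w))\<^sup>2)"
      by (subst sum.reindex) (auto simp: inj_on_def)
    also have "\<dots> \<le> (norm f)\<^sup>2"
      using that by (intro sum_norm_nth_le) simp
    finally show ?thesis .
  qed
  show "l2_nth (rstrip j f) w = l2_nth f (w @ [j])"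
    unfolding rstrip_def
    by (subst Abs_l2sum_inverse) (auto intro!: l2sum_of_bounded_sums(1)[of "norm f"] sums)
  show "norm (rstrip j f) \<le> norm f"
    unfolding rstrip_def by (intro l2sum_of_bounded_sums(2) sums norm_ge_zero)
qed

lemmas l2_nth_rstrip [simp] = rstrip_bounds(1)

lemma rstrip_bounded_ops: "rstrip j \<in> bounded_ops UNIV UNIV"
  by (auto simp: bounded_ops_def rstrip_bounds(2) intro!: l2_eqI exI[of _ 1])

text \<open>Taking an adjoint gives boundedness at once; the entries are recovered afterwards by
  testing against \<open>l2_single\<close>.\<close>

definition rappend :: "'n::finite \<Rightarrow> ('n, 'e::complex_hilbert) fock \<Rightarrow> ('n, 'e) fock" where
  "rappend j = adj (rstrip j)"

lemma rappend_bounded_ops: "rappend j \<in> bounded_ops UNIV UNIV"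
  unfolding rappend_def by (rule adj_bounded_ops[OF rstrip_bounded_ops])

lemma cinner_rappend: "cinner (rappend j f) g = cinner f (rstrip j g)"
  unfolding rappend_def by (rule cinner_adj'[OF rstrip_bounded_ops])

lemma l2_nth_rappend [simp]:
  fixes f :: "('n::finite, 'b::complex_hilbert) fock"
  shows "l2_nth (rappend j f) [] = 0"
  "l2_nth (rappend j f) (v @ [k]) = (if k = j then l2_nth f v else 0)"
proof -
  have eq: "cinner e (l2_nth (rappend j f) w) = cinner (rstrip j (l2_single w e)) f" for w e
    by (metis cinner_rappend cinner_l2_single cinner_commute)
  have "rstrip j (l2_single [] e) = 0" for e :: 'b
    by (rule l2_eqI) simp
  then show "l2_nth (rappend j f) [] = 0"
    by - (rule cinner_extensionality, simp add: eq)
  have "rstrip j (l2_single (v @ [k]) e) = (if k = j then l2_single v e else 0)" for e :: 'b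
    by (rule l2_eqI) simp
  then show "l2_nth (rappend j f) (v @ [k]) = (if k = j then l2_nth f v else 0)"
    by - (rule cinner_extensionality, simp add: eq cinner_l2_single)
qed

definition ldiag ::
    "('a::complex_hilbert \<Rightarrow> 'b::complex_hilbert) \<Rightarrow> ('i, 'a) l2sum \<Rightarrow> ('i, 'b) l2sum" where
  "ldiag M f = Abs_l2sum (\<lambda>i. M (l2_nth f i))"

lemma l2_nth_ldiag [simp]:
  assumes M: "M \<in> bounded_ops UNIV UNIV" shows "l2_nth (ldiag M f) i = M (l2_nth f i)"
proof -
  obtain K where "\<And>x. norm (M x) \<le> K * norm x"
    using bounded_ops_bound[OF M] by auto
  then have "square_summable (\<lambda>i. M (l2_nth f i))"
    by (intro square_summable_le[OF square_summable_nth]) auto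
  then show ?thesis by (simp add: ldiag_def Abs_l2sum_inverse)
qed

lemma ldiag_bounded_ops:
  assumes M: "M \<in> bounded_ops UNIV UNIV" shows "ldiag M \<in> bounded_ops UNIV UNIV"
proof -
  obtain K where K: "0 \<le> K" "\<And>x. norm (M x) \<le> K * norm x"
    using bounded_ops_bound[OF M] by auto
  have "norm (ldiag M f) \<le> K * norm f" for f :: "('c, 'a) l2sum"
    by (rule l2_norm_le) (auto simp: K M)
  then show ?thesis
    by (auto simp: bounded_ops_def l2_nth_ldiag[OF M] bounded_opsD(2,3)[OF M] intro!: l2_eqI)
qed

lemma cinner_ldiag:
  assumes M: "M \<in> bounded_ops UNIV UNIV" shows "cinner (ldiag M f) g = cinner f (ldiag (adj M) g)"
  unfolding cinner_l2sum.rep_eq by (simp add: M adj_bounded_ops[OF M] cinner_adj[OF M])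

section \<open>Levels\<close>

lemma closed_csubspace_level:
  assumes F: "closed_csubspace F" shows "closed_csubspace (level n F)"
proof -
  have eq: "level n F = (\<Inter>w. (\<lambda>f. l2_nth f w) -` F) \<inter>
      (\<Inter>w\<in>{w. length w \<noteq> n}. (\<lambda>f. l2_nth f w) -` {0})"
    by (auto simp: level_def)
  have "closed (level n F)"
    unfolding eq using closed_csubspaceD(1)[OF F]
    by (intro closed_Int closed_INT ballI continuous_closed_vimage closed_singleton
        linear_continuous_at[OF bounded_ops_linear[OF l2_nth_bounded_ops]])
  then show ?thesis
    unfolding closed_csubspace_def using closed_csubspaceD(2-4)[OF F] by (auto simp: level_def)
qed

lemma closed_csubspace_Times:
  assumes "closed_csubspace X" and "closed_csubspace Y" shows "closed_csubspace (X \<times> Y)"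
  using assms by (auto simp: closed_csubspace_def closed_Times scaleC_prod_def zero_prod_def)

lemma proj_level_in_level [simp]: "proj_level n f \<in> level n UNIV"
  by (simp add: level_def)

lemma proj_level_id: "f \<in> level n F \<Longrightarrow> proj_level n f = f"
  by (auto intro!: l2_eqI simp: level_def)

lemma strip_in_level: "f \<in> level (Suc n) F \<Longrightarrow> strip j f \<in> level n F"
  by (auto simp: level_def)

lemma strip_level_0: "f \<in> level 0 F \<Longrightarrow> strip j f = 0"
  by (auto intro!: l2_eqI simp: level_def)

lemma prepend_in_level:
  "f \<in> level n F \<Longrightarrow> 0 \<in> F \<Longrightarrow> prepend j f \<in> level (Suc n) F"
  unfolding level_def by (auto simp: prepend.rep_eq split: list.splits)

lemma proj_level_prepend:
  "proj_level (Suc n) (prepend j f) = prepend j (proj_level n f)"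
  "proj_level 0 (prepend j f) = 0"
  by (auto intro!: l2_eqI simp: prepend.rep_eq split: list.splits)

lemma fock_eqI_levels: "(\<And>n. proj_level n f = proj_level n g) \<Longrightarrow> f = g"
  by (rule l2_eqI) (metis proj_level.rep_eq)

lemma l2_nth_ampl:
  "l2_nth (ampl R f) [] = 0" "l2_nth (ampl R f) (k # v) = l2_nth (R (strip k f)) v"
  by (simp_all add: ampl_def)

lemma ampl_prepend: "R 0 = 0 \<Longrightarrow> ampl R (prepend j f) = prepend j (R f)"
proof (rule l2_eqI)
  show "l2_nth (ampl R (prepend j f)) w = l2_nth (prepend j (R f)) w" if "R 0 = 0" for w
    using that by (cases w) (auto simp: l2_nth_ampl strip_prepend)
qed

lemma prepend_zero [simp]: "prepend j 0 = 0"
  by (rule bounded_ops_zero[OF prepend_bounded_ops]) simp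

lemma strip_zero [simp]: "strip j 0 = 0"
  by (rule bounded_ops_zero[OF strip_bounded_ops]) simp

lemma prepend_add: "prepend j (f + g) = prepend j f + prepend j g"
  by (rule bounded_opsD(2)[OF prepend_bounded_ops]) auto

lemma ampl_zero: "R 0 = 0 \<Longrightarrow> ampl R 0 = 0"
  by (simp add: ampl_def)

section \<open>The Schur class in terms of intertwining\<close>

text \<open>Each strip shortens the words of source and target together. A vector of level
  \<open>j\<close> is killed by \<open>j + 1\<close> strips, whence triangularity; a single strip
  relates a block to its predecessor on the diagonal.\<close>

lemma schur_classI:
  assumes T: "T \<in> bounded_ops UNIV UNIV" and contr: "\<And>f. norm (T f) \<le> norm f"
    and strip: "\<And>j f. strip j (T f) = T (strip j f)"
  shows "T \<in> schur_class"
proof -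
  have nth: "l2_nth (T f) (k # v) = l2_nth (T (strip k f)) v" for f k v
    using arg_cong[OF strip[of k f], of "\<lambda>g. l2_nth g v"] by simp
  have zero: "l2_nth (T f) w = 0" if "f \<in> level j UNIV" "j < length w" for f w j
    using that
  proof (induction w arbitrary: f j)
    case (Cons k v)
    show ?case
    proof (cases j)
      case 0
      then have "strip k f = 0" using Cons.prems by (simp add: strip_level_0)
      then show ?thesis by (simp add: nth bounded_ops_zero[OF T])
    next
      case (Suc i)
      then have "strip k f \<in> level i UNIV" using Cons.prems by (simp add: strip_in_level)
      then show ?thesis using Cons.IH Cons.prems Suc by (simp add: nth)
    qed
  qed simp
  have "block T i j f = 0" if "j < i" "f \<in> level j UNIV" for i j f
    using that zero[OF that(2)] proj_level_id[OF that(2)] by (intro l2_eqI) (auto simp: block_def)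
  moreover have "block T i j f = ampl (block T (i - 1) (j - 1)) f"
    if "1 \<le> i" "i \<le> j" "f \<in> level j UNIV" for i j f
  proof -
    obtain i' j' where ij: "i = Suc i'" "j = Suc j'"
      using \<open>1 \<le> i\<close> \<open>i \<le> j\<close> by (cases i; cases j) auto
    have f: "proj_level j f = f" "proj_level j' (strip k f) = strip k f" for k
      using that(3) ij by (auto intro!: proj_level_id strip_in_level)
    have "l2_nth (block T i j f) w = l2_nth (ampl (block T (i - 1) (j - 1)) f) w" for w
      by (cases w) (auto simp: block_def l2_nth_ampl f[unfolded ij] ij nth)
    then show ?thesis by (rule l2_eqI)
  qed
  ultimately show ?thesis
    using T contr unfolding schur_class_def by blast
qed

text \<open>Compare coefficients at \<open>v\<close>. For short \<open>v\<close> the relation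
  between a block and its amplified predecessor applies; for long \<open>v\<close> both sides vanish
  by triangularity. At \<open>j = 0\<close> the right side is \<open>T 0\<close>.\<close>

lemma schur_class_level:
  assumes T: "T \<in> schur_class" and f: "f \<in> level j UNIV"
  shows "strip k (T f) = T (strip k f)"
proof (rule l2_eqI)
  fix v
  have upper: "l2_nth (T g) w = 0" if "g \<in> level i UNIV" "i < length w" for g i w
  proof -
    have "block T (length w) i g = 0"
      using T that unfolding schur_class_def by blast
    from arg_cong[OF this, of "\<lambda>h. l2_nth h w"] show ?thesis
      by (simp add: block_def proj_level_id[OF that(1)])
  qed
  have T0: "T 0 = 0"
    using T bounded_ops_zero[of T UNIV UNIV] by (simp add: schur_class_def)
  show "l2_nth (strip k (T f)) v = l2_nth (T (strip k f)) v"
  proof (cases j)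
    case 0
    then show ?thesis using upper[OF f, of "k # v"] strip_level_0[of f UNIV k] f T0 by simp
  next
    case (Suc i)
    have g: "strip k f \<in> level i UNIV" using f Suc by (simp add: strip_in_level)
    show ?thesis
    proof (cases "length v \<le> i")
      case True
      then have "block T (Suc (length v)) j f = ampl (block T (Suc (length v) - 1) (j - 1)) f"
        using T f Suc unfolding schur_class_def by simp
      from arg_cong[OF this, of "\<lambda>h. l2_nth h (k # v)"] show ?thesis
        using Suc f by (simp add: block_def l2_nth_ampl proj_level_id[OF f, unfolded Suc]
            proj_level_id[OF g])
    next
      case False
      then show ?thesis using upper[OF f, of "k # v"] upper[OF g, of v] Suc by simp
    qed
  qed
qed

text \<open>Testing against the vectors \<open>l2_single w e\<close>, which lie in a single level, replaces an
  approximation of \<open>f\<close> by its finite truncations.\<close>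

lemma schur_class_strip:
  fixes T :: "('n::finite, 'e1::complex_hilbert) fock \<Rightarrow> ('n, 'e2::complex_hilbert) fock"
  assumes T: "T \<in> schur_class"
  shows "adj T (prepend k u) = prepend k (adj T u)" and "strip k (T f) = T (strip k f)"
proof -
  have ops: "T \<in> bounded_ops UNIV UNIV" using T by (simp add: schur_class_def)
  show adj: "adj T (prepend k u) = prepend k (adj T u)" for u
  proof (rule l2_eqI, rule cinner_extensionality)
    fix w :: "'n list" and e :: 'e1
    have "l2_single w e \<in> level (length w) UNIV" by (simp add: level_def)
    then have "cinner (strip k (T (l2_single w e))) u = cinner (T (strip k (l2_single w e))) u"
      by (simp add: schur_class_level[OF T])
    then have "cinner (l2_single w e) (adj T (prepend k u))
        = cinner (l2_single w e) (prepend k (adj T u))"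
      by (simp add: cinner_strip[symmetric] cinner_adj[OF ops])
    then show "cinner e (l2_nth (adj T (prepend k u)) w)
        = cinner e (l2_nth (prepend k (adj T u)) w)"
      by (simp add: cinner_l2_single)
  qed
  have "cinner u (strip k (T f)) = cinner u (T (strip k f))" for u
    by (simp add: cinner_prepend[symmetric] cinner_adj'[OF ops, symmetric] adj)
  then show "strip k (T f) = T (strip k f)" by (rule cinner_extensionality)
qed

section \<open>Transfer maps of coisometric systems\<close>

text \<open>The adjoint is isometric on \<open>Y\<close>, so Cauchy-Schwarz bounds the squared norm
  of \<open>R x\<close>, which pairs \<open>x\<close> with the adjoint applied to
  \<open>R x\<close>, by \<open>norm x * norm (R x)\<close>.\<close>

lemma coisometry_on_norm_le:
  assumes X: "closed_csubspace X" and R: "coisometry_on X Y R" and x: "x \<in> X"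
  shows "norm (R x) \<le> norm x"
proof -
  let ?R = "adjoint_on X Y R"
  have ops: "R \<in> bounded_ops X Y" and id: "\<And>y. y \<in> Y \<Longrightarrow> R (?R y) = y"
    using R by (auto simp: coisometry_on_def)
  note adjoint = adjoint_on_correct[OF X ops]
  have y: "R x \<in> Y" using ops x by (rule bounded_opsD)
  have "cinner (?R (R x)) (?R (R x)) = cinner (R x) (R x)"
    using adjoint(2)[OF y adjoint(1)[OF y]] id[OF y] by simp
  then have eq: "norm (?R (R x)) = norm (R x)"
    by (rule norm_eq_if_cinner_self_eq)
  have "norm (R x) * norm (R x) = inner x (?R (R x))"
    using adjoint(2)[OF y x]
        by (simp add: inner_eq_Re_cinner power2_norm_eq_inner flip: power2_eq_square)
  also have "\<dots> \<le> norm x * norm (?R (R x))"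
    by (rule norm_cauchy_schwarz)
  finally show ?thesis unfolding eq by (cases "R x = 0") auto
qed

lemma BS_class_step:
  assumes F: "closed_csubspace F" and S: "\<Sigma> \<in> BS_class F"
    and x: "x \<in> level n F" and u: "u \<in> level n UNIV"
  shows "sysA \<Sigma> n x + sysB \<Sigma> n u \<in> level (Suc n) F" "sysC \<Sigma> n x + sysD \<Sigma> n u \<in> level n UNIV"
    "(norm (sysA \<Sigma> n x + sysB \<Sigma> n u))\<^sup>2 + (norm (sysC \<Sigma> n x + sysD \<Sigma> n u))\<^sup>2 \<le> (norm x)\<^sup>2
        + (norm u)\<^sup>2"
proof -
  have R: "coisometry_on (level n F \<times> level n UNIV) (level (Suc n) F \<times> level n UNIV) (system_matrix \<Sigma> n)"
    using S by (simp add: BS_class_def)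
  have "system_matrix \<Sigma> n (x, u) \<in> level (Suc n) F \<times> level n UNIV"
    using R x u bounded_opsD(1) unfolding coisometry_on_def by blast
  then show "sysA \<Sigma> n x + sysB \<Sigma> n u \<in> level (Suc n) F" "sysC \<Sigma> n x + sysD \<Sigma> n u \<in> level n UNIV"
    by (auto simp: system_matrix_def)
  have "norm (system_matrix \<Sigma> n (x, u)) \<le> norm (x, u)"
    using x u by (intro
        coisometry_on_norm_le[OF _ R] closed_csubspace_Times closed_csubspace_level F) auto
  then show "(norm (sysA \<Sigma> n x + sysB \<Sigma> n u))\<^sup>2 + (norm (sysC \<Sigma> n x + sysD \<Sigma> n u))\<^sup>2 \<le> (norm x)\<^sup>2
      + (norm u)\<^sup>2"
    by (simp add: system_matrix_def norm_Pair)
qed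

lemma state_seq_in_level:
  assumes F: "closed_csubspace F" and S: "\<Sigma> \<in> BS_class F"
  shows "state_seq \<Sigma> u n \<in> level n F"
proof (induction n)
  case 0
  show ?case using closed_csubspaceD(2)[OF closed_csubspace_level[OF F]] by simp
qed (simp add: BS_class_step[OF F S])

text \<open>The contractivity of the single steps, summed up. The current state stays on the left
  because its energy pays for the next step.\<close>

lemma energy_balance:
  assumes F: "closed_csubspace F" and S: "\<Sigma> \<in> BS_class F"
  shows "(norm (state_seq \<Sigma> u m))\<^sup>2 + (\<Sum>n<m. (norm (output_seq \<Sigma> u n))\<^sup>2)
    \<le> (\<Sum>n<m. (norm (proj_level n u))\<^sup>2)"
proof (induction m)
  case (Suc m)
  then show ?case
    using BS_class_step(3)[OF F S state_seq_in_level[OF F S, of u m] proj_level_in_level[of m u]]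
    by (simp add: output_seq_def)
qed simp

lemma sum_proj_level_norm:
  fixes f :: "('n::finite, 'e::complex_hilbert) fock"
  shows "(norm (\<Sum>n<m. proj_level n f))\<^sup>2 = (\<Sum>n<m. (norm (proj_level n f))\<^sup>2)"
proof (induction m)
  case (Suc m)
  have "cinner (proj_level n f) (proj_level m f) = 0" if "n < m" for n
    using that unfolding cinner_l2sum.rep_eq by (intro infsum_0) auto
  then have "inner (\<Sum>n<m. proj_level n f) (proj_level m f) = 0"
    by (simp add: inner_eq_Re_cinner cinner_sum_left)
  then show ?case
    using Suc by (simp add: power2_norm_eq_inner inner_add_left inner_add_right inner_commute)
qed simp

lemma nth_sum_proj_level:
  "l2_nth (\<Sum>n<m. proj_level n f) w = (if length w < m then l2_nth f w else 0)"
  by simp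

text \<open>A finite set of words meets only finitely many levels, so every finite partial sum for
  \<open>f\<close> is controlled by a truncation of \<open>g\<close>.\<close>

lemma norm_le_if_level_sums_le:
  assumes "\<And>m. (\<Sum>n<m. (norm (proj_level n f))\<^sup>2) \<le> (\<Sum>n<m. (norm (proj_level n g))\<^sup>2)"
  shows "norm f \<le> norm g"
proof -
  have "(\<Sum>w\<in>S. (norm (l2_nth f w))\<^sup>2) \<le> (norm g)\<^sup>2" if "finite S" for S
  proof -
    define m where "m = Suc (Max (length ` S))"
    have len: "length w < m" if "w \<in> S" for w
      using \<open>finite S\<close> that by (simp add: m_def less_Suc_eq_le)
    have "(\<Sum>w\<in>S. (norm (l2_nth f w))\<^sup>2) = (\<Sum>w\<in>S. (norm (l2_nth (\<Sum>n<m. proj_level n f) w))\<^sup>2)"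
      by (intro sum.cong refl) (simp add: nth_sum_proj_level len del: l2_nth_sum)
    also have "\<dots> \<le> (norm (\<Sum>n<m. proj_level n f))\<^sup>2"
      by (rule sum_norm_nth_le[OF that])
    also have "\<dots> \<le> (norm (\<Sum>n<m. proj_level n g))\<^sup>2"
      unfolding sum_proj_level_norm by (rule assms)
    also have "\<dots> \<le> (norm g)\<^sup>2"
      using l2_norm_le[of 1 "\<Sum>n<m. proj_level n g" g]
      by (intro power_mono) (auto simp: nth_sum_proj_level simp del: l2_nth_sum)
    finally show ?thesis .
  qed
  then show ?thesis
    using l2sum_of_bounded_sums(2)[of "norm g" "l2_nth f"] by (simp add: l2_nth_inverse)
qed

lemma BS_classD:
  assumes "\<Sigma> \<in> BS_class F"
  shows "sysA \<Sigma> 0 \<in> bounded_ops (level 0 F) (level 1 F)"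
    "sysB \<Sigma> 0 \<in> bounded_ops (level 0 UNIV) (level 1 F)"
    "sysC \<Sigma> 0 \<in> bounded_ops (level 0 F) (level 0 UNIV)"
    "sysD \<Sigma> 0 \<in> bounded_ops (level 0 UNIV) (level 0 UNIV)"
    "x \<in> level (Suc n) F \<Longrightarrow> sysA \<Sigma> (Suc n) x = ampl (sysA \<Sigma> n) x"
    "u \<in> level (Suc n) UNIV \<Longrightarrow> sysB \<Sigma> (Suc n) u = ampl (sysB \<Sigma> n) u"
    "x \<in> level (Suc n) F \<Longrightarrow> sysC \<Sigma> (Suc n) x = ampl (sysC \<Sigma> n) x"
    "u \<in> level (Suc n) UNIV \<Longrightarrow> sysD \<Sigma> (Suc n) u = ampl (sysD \<Sigma> n) u"
  using assms unfolding BS_class_def by simp_all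

lemma BS_class_zero:
  assumes F: "closed_csubspace F" and S: "\<Sigma> \<in> BS_class F"
  shows "sysA \<Sigma> n 0 = 0 \<and> sysB \<Sigma> n 0 = 0 \<and> sysC \<Sigma> n 0 = 0 \<and> sysD \<Sigma> n 0 = 0"
proof -
  note zero = closed_csubspaceD(2)[OF closed_csubspace_level]
  show ?thesis
    by (induction n) (simp_all add:
        BS_classD[OF S] BS_classD(1-4)[OF S, THEN bounded_ops_zero] ampl_zero
        zero F)
qed

text \<open>On a vector living in the \<open>j\<close>-th copy, the amplified operators of time
  \<open>n + 1\<close> repeat those of time \<open>n\<close> inside that copy. The delay starts
  properly because the prepended input vanishes at level 0.\<close>

lemma transfer_prepend:
  fixes \<Sigma> :: "('n::finite, 'e1::complex_hilbert, 'e2::complex_hilbert, 'f::complex_hilbert) system"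
  assumes F: "closed_csubspace F" and S: "\<Sigma> \<in> BS_class F"
  shows "state_seq \<Sigma> (prepend j u) (Suc n) = prepend j (state_seq \<Sigma> u n)"
    and "output_seq \<Sigma> (prepend j u) (Suc n) = prepend j (output_seq \<Sigma> u n)"
    and "output_seq \<Sigma> (prepend j u) 0 = 0"
proof -
  note zero = BS_class_zero[OF F S]
  have prep: "prepend j x \<in> level (Suc n) F" if "x \<in> level n F" for x n
    using that closed_csubspaceD(2)[OF F] by (rule prepend_in_level)
  have prep': "prepend j v \<in> level (Suc n) UNIV" if "v \<in> level n UNIV" for v ::
      "('n, 'e2) fock" and n
    using that by (rule prepend_in_level) simp
  have ABCD: "sysA \<Sigma> (Suc n) (prepend j x) = prepend j (sysA \<Sigma> n x)"
      "sysC \<Sigma> (Suc n) (prepend j x) = prepend j (sysC \<Sigma> n x)"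
      "sysB \<Sigma> (Suc n) (prepend j v) = prepend j (sysB \<Sigma> n v)"
      "sysD \<Sigma> (Suc n) (prepend j v) = prepend j (sysD \<Sigma> n v)"
    if "x \<in> level n F" "v \<in> level n UNIV" for x v n
    using prep[OF that(1)] prep'[OF that(2)] zero[of n] by (simp_all add:
        BS_classD[OF S] ampl_prepend)
  show state: "state_seq \<Sigma> (prepend j u) (Suc n) = prepend j (state_seq \<Sigma> u n)" for n
  proof (induction n)
    case 0
    show ?case using zero[of 0] by (simp add: proj_level_prepend prepend_zero)
  next
    case (Suc n)
    have "state_seq \<Sigma> (prepend j u) (Suc (Suc n)) = sysA \<Sigma> (Suc n) (prepend j (state_seq \<Sigma> u n))
        + sysB \<Sigma> (Suc n) (prepend j (proj_level n u))"
      unfolding state_seq.simps(2)[of \<Sigma> "prepend j u" "Suc n"] Suc proj_level_prepend ..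
    then show ?case
      by (simp add: ABCD[OF state_seq_in_level[OF F S] proj_level_in_level] prepend_add)
  qed
  show "output_seq \<Sigma> (prepend j u) (Suc n) = prepend j (output_seq \<Sigma> u n)"
    unfolding output_seq_def state proj_level_prepend
    by (simp add: ABCD[OF state_seq_in_level[OF F S] proj_level_in_level] prepend_add)
  show "output_seq \<Sigma> (prepend j u) 0 = 0"
    using zero[of 0] by (simp add: output_seq_def proj_level_prepend)
qed

lemma schur_class_if_transfer_map:
  fixes T :: "('n::finite, 'e1::complex_hilbert) fock \<Rightarrow> ('n, 'e2::complex_hilbert) fock"
  assumes T: "T \<in> bounded_ops UNIV UNIV"
    and F: "closed_csubspace F" and S: "\<Sigma> \<in> BS_class F" and tm: "is_transfer_map \<Sigma> (adj T)"
  shows "T \<in> schur_class"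
proof (rule schur_classI[OF T])
  have nth: "proj_level n (adj T u) = output_seq \<Sigma> u n" for u n
    using tm by (simp add: is_transfer_map_def)
  have adj_contr: "norm (adj T u) \<le> norm u" for u
  proof (rule norm_le_if_level_sums_le)
    show "(\<Sum>n<m. (norm (proj_level n (adj T u)))\<^sup>2) \<le> (\<Sum>n<m. (norm (proj_level n u))\<^sup>2)" for m
      using energy_balance[OF F S, of u m] zero_le_power2[of "norm (state_seq \<Sigma> u m)"]
      unfolding nth by linarith
  qed
  show "norm (T f) \<le> norm f" for f
    using norm_le_if_adjoint_pair[of "adj T" T 1 f] adj_contr by (simp add: cinner_adj'[OF T])
  have comm: "adj T (prepend j u) = prepend j (adj T u)" for j u
  proof (rule fock_eqI_levels)
    show "proj_level n (adj T (prepend j u)) = proj_level n (prepend j (adj T u))" for n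
      by (cases n) (auto simp: nth transfer_prepend[OF F S] proj_level_prepend)
  qed
  show "strip j (T f) = T (strip j f)" for j f
  proof (rule cinner_extensionality)
    show "cinner u (strip j (T f)) = cinner u (T (strip j f))" for u
      by (simp add: cinner_prepend[symmetric] cinner_adj'[OF T, symmetric] comm)
  qed
qed

section \<open>The functional model\<close>

text \<open>\<open>\<Delta>\<close> is the defect operator of \<open>T\<close>; it identifies \<open>F\<close> with the de Branges-Rovnyak space of
  the multiplier \<open>adj T\<close>, on which the model operators are \<open>strip j\<close> and evaluation at the empty
  word. \<open>A\<close> and \<open>B\<close> exist by the lemma \<open>douglas\<close>.\<close>

locale functional_model =
  fixes T :: "('n::finite, 'e1::complex_hilbert) fock \<Rightarrow> ('n, 'e2::complex_hilbert) fock"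
    and \<Delta> :: "('n, 'e1) fock \<Rightarrow> ('n, 'e1) fock"
    and A :: "'n \<Rightarrow> ('n, 'e1) fock \<Rightarrow> ('n, 'e1) fock"
    and B :: "'n \<Rightarrow> 'e2 \<Rightarrow> ('n, 'e1) fock"
  assumes T: "T \<in> schur_class"
    and \<Delta>: "\<Delta> \<in> bounded_ops UNIV UNIV" "cinner (\<Delta> f) g = cinner f (\<Delta> g)"
      "\<Delta> (\<Delta> f) = f - adj T (T f)"
    and A: "A j \<in> bounded_ops UNIV UNIV" "A j x \<in> closure (range \<Delta>)"
      "adj (A j) (\<Delta> f) = \<Delta> (prepend j f)"
    and B: "B j \<in> bounded_ops UNIV UNIV" "B j u \<in> closure (range \<Delta>)"
      "adj (B j) (\<Delta> f) = l2_nth (T (prepend j f)) []"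
begin

abbreviation F :: "('n, 'e1) fock set" where
  "F \<equiv> closure (range \<Delta>)"

definition C :: "('n, 'e1) fock \<Rightarrow> 'e1" where
  "C x = l2_nth (\<Delta> x) []"

definition D :: "'e2 \<Rightarrow> 'e1" where
  "D u = l2_nth (adj T (l2_single [] u)) []"

lemma T_ops: "T \<in> bounded_ops UNIV UNIV"
  using T by (simp add: schur_class_def)

lemmas adj_T_ops = adj_bounded_ops[OF T_ops]

lemma C_ops: "C \<in> bounded_ops UNIV UNIV"
  unfolding C_def[abs_def] by (rule bounded_ops_compose[OF l2_nth_bounded_ops \<Delta>(1)])

lemma D_ops: "D \<in> bounded_ops UNIV UNIV"
  unfolding D_def[abs_def]
  by (intro bounded_ops_compose[OF l2_nth_bounded_ops]
      bounded_ops_compose[OF adj_T_ops l2_single_bounded_ops])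

lemma adj_C: "adj C e = \<Delta> (l2_single [] e)"
  by (rule adj_eqI) (simp add: C_def \<Delta>(2)[symmetric] cinner_l2_single_right)

lemma adj_D: "adj D e = l2_nth (T (l2_single [] e)) []"
  by (rule adj_eqI) (simp add: D_def cinner_l2_single[symmetric] cinner_l2_single_right[symmetric]
      cinner_adj'[OF T_ops])

lemma F_closed: "closed_csubspace F"
  by (rule closed_csubspace_closure_range[OF \<Delta>(1)])

lemma range_in_F: "\<Delta> f \<in> F"
  by (rule subsetD[OF closure_subset rangeI])

text \<open>The kernel of the self-adjoint \<open>\<Delta>\<close> is orthogonal to its range.
  Equations in \<open>F\<close> may thus be checked after applying \<open>\<Delta>\<close>.\<close>

lemma \<Delta>_inj:
  assumes "x \<in> F" and "y \<in> F" and "\<Delta> x = \<Delta> y" shows "x = y"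
proof -
  have "cinner (\<Delta> f) (x - y) = 0" for f
    using assms(3) by (simp add: \<Delta>(2) bounded_ops_diff[OF \<Delta>(1)])
  then have "inner (x - y) (x - y) = 0"
    using closed_csubspaceD(5)[OF F_closed assms(1,2)] by (rule closure_range_orthogonal)
  then show ?thesis by simp
qed

lemma \<Delta>_A: "\<Delta> (A j x) = strip j (\<Delta> x)"
proof (rule cinner_extensionality)
  show "cinner f (\<Delta> (A j x)) = cinner f (strip j (\<Delta> x))" for f
    by (simp add: \<Delta>(2)[symmetric] cinner_adj'[OF A(1), symmetric] A(3) cinner_prepend[symmetric])
qed

lemma \<Delta>_B: "\<Delta> (B j u) = strip j (adj T (l2_single [] u))"
proof (rule cinner_extensionality)
  show "cinner f (\<Delta> (B j u)) = cinner f (strip j (adj T (l2_single [] u)))" for f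
    by (simp add: \<Delta>(2)[symmetric] cinner_adj'[OF B(1), symmetric] B(3) cinner_prepend[symmetric]
        cinner_adj[OF T_ops] cinner_l2_single_right)
qed

text \<open>Since \<open>adj T\<close> commutes with \<open>prepend k\<close>, expanding
  \<open>g\<close> by its first letter expands \<open>adj T g\<close> as well.\<close>

lemma adj_T_decompose:
  "adj T g = adj T (l2_single [] (l2_nth g [])) + (\<Sum>k\<in>UNIV. prepend k (adj T (strip k g)))"
proof -
  have "adj T g = adj T (l2_single [] (l2_nth g []) + (\<Sum>k\<in>UNIV. prepend k (strip k g)))"
    using fock_decompose[of g] by simp
  also have "\<dots> = adj T (l2_single [] (l2_nth g [])) + (\<Sum>k\<in>UNIV. adj T (prepend k (strip k g)))"
    by (simp add: bounded_opsD(2)[OF adj_T_ops] bounded_ops_sum[OF adj_T_ops])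
  finally show ?thesis by (simp add: schur_class_strip(1)[OF T])
qed

text \<open>Replace the square of \<open>\<Delta>\<close> by 1 - S T and expand S at
  \<open>T g\<close>: the contribution of the value of \<open>T g\<close> at the empty word
  cancels.\<close>

lemma model_identity:
  "\<Delta> (\<Delta> g) + adj T (l2_single [] (l2_nth (T g) []))
      = g - (\<Sum>k\<in>UNIV. prepend k (adj T (T (strip k g))))"
  using adj_T_decompose[of "T g"] by (simp add: \<Delta>(3) schur_class_strip(2)[OF T])

text \<open>The action of the system on the pairs that its adjoint produces. Under
  \<open>\<Delta>\<close>, the operators \<open>A i\<close> and \<open>B i\<close> turn into strips,
  so both equations are read off from \<open>model_identity\<close>.\<close>

lemma model_step:
  "\<Delta> (A i (\<Delta> g) + B i (l2_nth (T g) [])) = \<Delta> (\<Delta> (strip i g))"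
  "C (\<Delta> g) + D (l2_nth (T g) []) = l2_nth g []"
proof -
  have "\<Delta> (A i (\<Delta> g) + B i (l2_nth (T g) []))
      = strip i (\<Delta> (\<Delta> g) + adj T (l2_single [] (l2_nth (T g) [])))"
    by (simp add: bounded_opsD(2)[OF \<Delta>(1)] bounded_opsD(2)[OF strip_bounded_ops] \<Delta>_A \<Delta>_B)
  also have "\<dots> = strip i g - (\<Sum>k\<in>UNIV. strip i (prepend k (adj T (T (strip k g)))))"
    unfolding model_identity
    by (simp add: bounded_ops_diff[OF strip_bounded_ops] bounded_ops_sum[OF strip_bounded_ops])
  also have "\<dots> = \<Delta> (\<Delta> (strip i g))"
    by (simp add: strip_prepend \<Delta>(3))
  finally show "\<Delta> (A i (\<Delta> g) + B i (l2_nth (T g) [])) = \<Delta> (\<Delta> (strip i g))" .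
  have "C (\<Delta> g) + D (l2_nth (T g) []) = l2_nth (\<Delta> (\<Delta> g)
      + adj T (l2_single [] (l2_nth (T g) []))) []"
    by (simp add: C_def D_def)
  then show "C (\<Delta> g) + D (l2_nth (T g) []) = l2_nth g []"
    unfolding model_identity by simp
qed

lemma F_continuous_eqI:
  fixes R R' :: "('n, 'e1) fock \<Rightarrow> 'x::complex_hilbert"
  assumes "R \<in> bounded_ops UNIV UNIV" and "R' \<in> bounded_ops UNIV UNIV"
    and "\<And>f. R (\<Delta> f) = R' (\<Delta> f)" and "p \<in> F"
  shows "R p = R' p"
proof -
  have "F \<subseteq> {p. R p = R' p}"
  proof (rule closure_minimal)
    show "closed {p. R p = R' p}"
      by (intro closed_Collect_eq linear_continuous_on bounded_ops_linear[where Y = UNIV] assms)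
  qed (auto simp: assms(3))
  then show ?thesis using assms(4) by blast
qed

text \<open>The blocks of the system times its adjoint. Each is \<open>model_step\<close> at a
  suitable \<open>g\<close>: the column of \<open>p = \<Delta> f\<close> belongs to
  \<open>g = prepend j f\<close>, that of \<open>e\<close> to \<open>g = l2_single [] e\<close>.
  Density carries the former to all of \<open>F\<close>.\<close>

lemma coisometry_identities:
  shows "p \<in> F \<Longrightarrow> A i (adj (A j) p) + B i (adj (B j) p) = (if i = j then p else 0)"
    and "p \<in> F \<Longrightarrow> C (adj (A j) p) + D (adj (B j) p) = 0"
    and "A i (adj C e) + B i (adj D e) = 0"
    and "C (adj C e) + D (adj D e) = e"
proof -
  have sum_F: "A i x + B i u \<in> F" for x u
    by (intro closed_csubspaceD(3)[OF F_closed] A B)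
  have step: "A i (\<Delta> g) + B i (l2_nth (T g) []) = \<Delta> (strip i g)" for g
    by (rule \<Delta>_inj[OF sum_F range_in_F model_step(1)])
  show "A i (adj C e) + B i (adj D e) = 0" "C (adj C e) + D (adj D e) = e"
    using step[of "l2_single [] e"] model_step(2)[of "l2_single [] e"]
      strip_level_0[of "l2_single [] e" UNIV i] bounded_ops_zero[OF \<Delta>(1)]
    by (simp_all add: adj_C adj_D level_def)
  assume p: "p \<in> F"
  show "A i (adj (A j) p) + B i (adj (B j) p) = (if i = j then p else 0)"
  proof (rule F_continuous_eqI[OF _ _ _ p, of "\<lambda>p. A i (adj (A j) p) + B i (adj (B j) p)"
        "\<lambda>p. if i = j then p else 0"])
    show "(\<lambda>p. A i (adj (A j) p) + B i (adj (B j) p)) \<in> bounded_ops UNIV UNIV"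
      by (intro bounded_ops_add bounded_ops_compose[OF A(1)] bounded_ops_compose[OF B(1)]
          adj_bounded_ops A B)
    show "(\<lambda>p. if i = j then p else 0) \<in> bounded_ops UNIV UNIV"
      by (cases "i = j") (auto simp: bounded_ops_id bounded_ops_def intro: exI[of _ 0] exI[of _ 1])
    show "A i (adj (A j) (\<Delta> f)) + B i (adj (B j) (\<Delta> f)) = (if i = j then \<Delta> f else 0)" for f
      unfolding A(3) B(3) step by (simp add: strip_prepend bounded_ops_zero[OF \<Delta>(1)])
  qed
  show "C (adj (A j) p) + D (adj (B j) p) = 0"
  proof (rule F_continuous_eqI[OF _ _ _ p, of "\<lambda>p. C (adj (A j) p) + D (adj (B j) p)" "\<lambda>p. 0"])
    show "(\<lambda>p. C (adj (A j) p) + D (adj (B j) p)) \<in> bounded_ops UNIV UNIV"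
      by (intro bounded_ops_add bounded_ops_compose[OF C_ops] bounded_ops_compose[OF D_ops]
          adj_bounded_ops A B)
    show "(\<lambda>p. 0) \<in> bounded_ops UNIV UNIV"
      by (auto simp: bounded_ops_def intro: exI[of _ 0])
    show "C (adj (A j) (\<Delta> f)) + D (adj (B j) (\<Delta> f)) = 0" for f
      unfolding A(3) B(3) model_step(2) by simp
  qed
qed

text \<open>\<open>adj\<close> is formed in the ambient space; invariance of \<open>F\<close> makes
  it usable as the adjoint for the state space \<open>F\<close>.\<close>

lemma adj_A_F: "p \<in> F \<Longrightarrow> adj (A j) p \<in> F"
proof -
  have "adj (A j) ` F \<subseteq> F"
  proof (rule image_closure_subset)
    show "continuous_on F (adj (A j))"
      by (intro linear_continuous_on bounded_ops_linear[where Y = UNIV] adj_bounded_ops A)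
  qed (auto simp: A(3) range_in_F)
  then show "p \<in> F \<Longrightarrow> adj (A j) p \<in> F" by blast
qed

text \<open>The coordinate at \<open>w\<close> feeds the coordinates at \<open>w @ [j]\<close>, for
  words of every length at once. Therefore \<open>model\<close> needs no dependence on time.\<close>

definition opA :: "('n, ('n, 'e1) fock) fock \<Rightarrow> ('n, ('n, 'e1) fock) fock" where
  "opA x = (\<Sum>j\<in>UNIV. rappend j (ldiag (A j) x))"

definition opB :: "('n, 'e2) fock \<Rightarrow> ('n, ('n, 'e1) fock) fock" where
  "opB u = (\<Sum>j\<in>UNIV. rappend j (ldiag (B j) u))"

definition model :: "('n, 'e1, 'e2, ('n, 'e1) fock) system" where
  "model = \<lparr>sysA = (\<lambda>n. opA), sysB = (\<lambda>n. opB), sysC = (\<lambda>n. ldiag C), sysD = (\<lambda>n. ldiag D)\<rparr>"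

lemma op_ops:
  "opA \<in> bounded_ops UNIV UNIV" "opB \<in> bounded_ops UNIV UNIV"
  unfolding opA_def[abs_def] opB_def[abs_def]
  by (intro bounded_ops_sum_op bounded_ops_compose[OF rappend_bounded_ops] ldiag_bounded_ops A B)+

lemma l2_nth_op [simp]:
  "l2_nth (opA x) [] = 0" "l2_nth (opA x) (w @ [j]) = A j (l2_nth x w)"
  "l2_nth (opB u) [] = 0" "l2_nth (opB u) (w @ [j]) = B j (l2_nth u w)"
  by (simp_all add: opA_def opB_def A(1) B(1) l2_nth_ldiag)

text \<open>Removing the first letter commutes with adding a last one, except at words of length 1,
  where the two letters coincide. There the level assumption helps: the entry at \<open>[]\<close>
  is zero.\<close>

lemma l2_nth_op_Cons:
  assumes "x \<in> level (Suc n) X" and "u \<in> level (Suc n) U"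
  shows "l2_nth (opA x) (k # v) = l2_nth (opA (strip k x)) v"
    and "l2_nth (opB u) (k # v) = l2_nth (opB (strip k u)) v"
proof -
  have zero: "l2_nth x [] = 0" "l2_nth u [] = 0"
    using assms by (auto simp: level_def)
  show "l2_nth (opA x) (k # v) = l2_nth (opA (strip k x)) v"
    by (cases v rule: rev_cases)
      (use l2_nth_op(2)[of x "[]" k] l2_nth_op(2)[of x "k # _"] zero
          bounded_ops_zero[OF A(1)] in auto)
  show "l2_nth (opB u) (k # v) = l2_nth (opB (strip k u)) v"
    by (cases v rule: rev_cases)
      (use l2_nth_op(4)[of u "[]" k] l2_nth_op(4)[of u "k # _"] zero
          bounded_ops_zero[OF B(1)] in auto)
qed

lemma op_in_level:
  "x \<in> level n X \<Longrightarrow> opA x \<in> level (Suc n) F"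
  "u \<in> level n U \<Longrightarrow> opB u \<in> level (Suc n) F"
proof -
  have zero: "0 \<in> F" using F_closed by (rule closed_csubspaceD)
  show "x \<in> level n X \<Longrightarrow> opA x \<in> level (Suc n) F"
    unfolding level_def mem_Collect_eq
  proof (intro allI)
    show "l2_nth (opA x) w \<in> F \<and> (length w \<noteq> Suc n \<longrightarrow> l2_nth (opA x) w = 0)"
      if "\<forall>w. l2_nth x w \<in> X \<and> (length w \<noteq> n \<longrightarrow> l2_nth x w = 0)" for w
      using that by (cases w rule: rev_cases) (simp_all add: zero A(2) bounded_ops_zero[OF A(1)])
  qed
  show "u \<in> level n U \<Longrightarrow> opB u \<in> level (Suc n) F"
    unfolding level_def mem_Collect_eq
  proof (intro allI)
    show "l2_nth (opB u) w \<in> F \<and> (length w \<noteq> Suc n \<longrightarrow> l2_nth (opB u) w = 0)"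
      if "\<forall>w. l2_nth u w \<in> U \<and> (length w \<noteq> n \<longrightarrow> l2_nth u w = 0)" for w
      using that by (cases w rule: rev_cases) (simp_all add: zero B(2) bounded_ops_zero[OF B(1)])
  qed
qed

lemma ldiag_in_level:
  "R \<in> bounded_ops UNIV UNIV \<Longrightarrow> f \<in> level n X \<Longrightarrow> ldiag R f \<in> level n UNIV"
  by (auto simp: level_def l2_nth_ldiag bounded_ops_zero)

lemma ldiag_ampl:
  assumes "R \<in> bounded_ops UNIV UNIV" and "f \<in> level (Suc n) X"
  shows "ldiag R f = ampl (ldiag R) f"
proof (rule l2_eqI)
  have "l2_nth f [] = 0" using assms(2) by (auto simp: level_def)
  then show "l2_nth (ldiag R f) w = l2_nth (ampl (ldiag R) f) w" for w
    by (cases w) (simp_all add: l2_nth_ampl assms(1) bounded_ops_zero[OF assms(1)])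
qed

lemma op_ampl:
  assumes "x \<in> level (Suc n) X" and "u \<in> level (Suc n) U"
  shows "opA x = ampl opA x" and "opB u = ampl opB u"
proof -
  have "l2_nth (opA x) w = l2_nth (ampl opA x) w" "l2_nth (opB u) w = l2_nth (ampl opB u) w" for w
    by (cases w; simp add: l2_nth_ampl l2_nth_op_Cons[OF assms])+
  then show "opA x = ampl opA x" and "opB u = ampl opB u"
    by (blast intro: l2_eqI)+
qed

section \<open>The adjoint of the system matrix\<close>

definition dualA :: "('n, ('n, 'e1) fock) fock \<Rightarrow> ('n, ('n, 'e1) fock) fock" where
  "dualA x = (\<Sum>j\<in>UNIV. ldiag (adj (A j)) (rstrip j x))"

definition dualB :: "('n, ('n, 'e1) fock) fock \<Rightarrow> ('n, 'e2) fock" where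
  "dualB x = (\<Sum>j\<in>UNIV. ldiag (adj (B j)) (rstrip j x))"

lemma cinner_op:
  "cinner (opA x) p = cinner x (dualA p)" "cinner (opB u) p = cinner u (dualB p)"
  by (simp_all add: opA_def opB_def dualA_def dualB_def cinner_sum_left cinner_sum_right
      cinner_rappend cinner_ldiag A(1) B(1))

lemma l2_nth_dual:
  "l2_nth (dualA p) w = (\<Sum>j\<in>UNIV. adj (A j) (l2_nth p (w @ [j])))"
  "l2_nth (dualB p) w = (\<Sum>j\<in>UNIV. adj (B j) (l2_nth p (w @ [j])))"
  by (simp_all add: dualA_def dualB_def adj_bounded_ops A(1) B(1) l2_nth_ldiag)

lemma dual_in_level:
  assumes p: "p \<in> level (Suc n) F" and e: "e \<in> level n U"
  shows "dualA p + ldiag (adj C) e \<in> level n F" and "dualB p + ldiag (adj D) e \<in> level n UNIV"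
proof -
  note nth = l2_nth_dual l2_nth_ldiag[OF adj_bounded_ops[OF C_ops]] l2_nth_ldiag[OF
      adj_bounded_ops[OF D_ops]]
  have pF: "l2_nth p w \<in> F" for w using p by (auto simp: level_def)
  have zero: "l2_nth p (w @ [j]) = 0" "l2_nth e w = 0" if "length w \<noteq> n" for w j
    using p e that by (auto simp: level_def)
  show "dualA p + ldiag (adj C) e \<in> level n F"
    unfolding level_def
    by (auto simp: nth zero adj_C range_in_F pF adj_A_F bounded_ops_zero[OF adj_bounded_ops] A(1)
        bounded_ops_zero[OF l2_single_bounded_ops] bounded_ops_zero[OF \<Delta>(1)]
        intro!: closed_csubspaceD(3)[OF F_closed] closed_csubspace_sum[OF F_closed])
  show "dualB p + ldiag (adj D) e \<in> level n UNIV"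
    unfolding level_def
    by (auto simp: nth zero bounded_ops_zero[OF adj_bounded_ops] B(1) D_ops)
qed

text \<open>At a word \<open>v @ [i]\<close>, the sum over the appended letters \<open>j\<close>
  collapses to \<open>j = i\<close> by the block identities, and the mixed terms vanish.\<close>

lemma dual_right_inverse:
  assumes p: "p \<in> level (Suc n) F"
  shows "opA (dualA p + ldiag (adj C) e) + opB (dualB p + ldiag (adj D) e) = p"
    and "ldiag C (dualA p + ldiag (adj C) e) + ldiag D (dualB p + ldiag (adj D) e) = e"
proof -
  note nth = l2_nth_dual l2_nth_ldiag[OF adj_bounded_ops[OF C_ops]] l2_nth_ldiag[OF
      adj_bounded_ops[OF D_ops]]
    l2_nth_ldiag[OF C_ops] l2_nth_ldiag[OF D_ops]
  have pF: "l2_nth p w \<in> F" for w using p by (auto simp: level_def)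
  have distrib: "R ((\<Sum>j\<in>UNIV. g j) + y) = (\<Sum>j\<in>UNIV. R (g j)) + R y"
    if "R \<in> bounded_ops UNIV UNIV" for R :: "'a::complex_hilbert \<Rightarrow> 'b::complex_hilbert" and g ::
        "'n \<Rightarrow> 'a" and y
    by (simp add: bounded_opsD(2)[OF that] bounded_ops_sum[OF that])
  show "opA (dualA p + ldiag (adj C) e) + opB (dualB p + ldiag (adj D) e) = p"
  proof (rule l2_eqI)
    fix w
    show "l2_nth (opA (dualA p + ldiag (adj C) e) + opB (dualB p + ldiag (adj D) e)) w = l2_nth p w"
    proof (cases w rule: rev_cases)
      case Nil
      then show ?thesis using p by (simp add: level_def)
    next
      case (snoc v i)
      have "l2_nth (opA (dualA p + ldiag (adj C) e) + opB (dualB p + ldiag (adj D) e)) (v @ [i])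
         = (\<Sum>j\<in>UNIV. A i (adj (A j) (l2_nth p (v @ [j]))) + B i (adj (B j) (l2_nth p (v @ [j]))))
           + (A i (adj C (l2_nth e v)) + B i (adj D (l2_nth e v)))"
        by (simp add: nth distrib[OF A(1)] distrib[OF B(1)] sum.distrib)
      then show ?thesis
        unfolding snoc by (simp add: coisometry_identities pF)
    qed
  qed
  show "ldiag C (dualA p + ldiag (adj C) e) + ldiag D (dualB p + ldiag (adj D) e) = e"
  proof (rule l2_eqI)
    fix w
    have "l2_nth (ldiag C (dualA p + ldiag (adj C) e) + ldiag D (dualB p + ldiag (adj D) e)) w
       = (\<Sum>j\<in>UNIV. C (adj (A j) (l2_nth p (w @ [j]))) + D (adj (B j) (l2_nth p (w @ [j]))))
         + (C (adj C (l2_nth e w)) + D (adj D (l2_nth e w)))"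
      by (simp add: nth distrib[OF C_ops] distrib[OF D_ops] sum.distrib)
    then show "l2_nth (ldiag C (dualA p + ldiag (adj C) e) + ldiag D (dualB p + ldiag (adj D) e)) w
        = l2_nth e w"
      by (simp add: coisometry_identities pF)
  qed
qed

lemma model_coisometry:
  "coisometry_on (level n F \<times> level n UNIV) (level (Suc n) F \<times> level n UNIV) (system_matrix model n)"
proof -
  let ?X = "level n F \<times> level n (UNIV :: 'e2 set)" and ?Y =
      "level (Suc n) F \<times> level n (UNIV :: 'e1 set)"
  let ?R = "system_matrix model n"
  have R: "?R z = (opA (fst z) + opB (snd z), ldiag C (fst z) + ldiag D (snd z))" for z
    by (simp add: system_matrix_def model_def split: prod.split)
  have X: "closed_csubspace ?X"
    by (intro closed_csubspace_Times closed_csubspace_level F_closed closed_csubspace_UNIV)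
  have fst_snd: "fst \<in> bounded_ops UNIV UNIV" "snd \<in> bounded_ops UNIV UNIV"
    by (intro bounded_opsI bounded_linear_fst bounded_linear_snd; simp add: scaleC_prod_def)+
  have R_ops: "?R \<in> bounded_ops UNIV UNIV"
  proof (rule bounded_opsI)
    have "(\<lambda>z. opA (fst z) + opB (snd z)) \<in> bounded_ops UNIV UNIV"
      "(\<lambda>z. ldiag C (fst z) + ldiag D (snd z)) \<in> bounded_ops UNIV UNIV"
      by (intro bounded_ops_add bounded_ops_compose[OF op_ops(1)] bounded_ops_compose[OF op_ops(2)]
          bounded_ops_compose[OF ldiag_bounded_ops] fst_snd C_ops D_ops)+
    then show "bounded_linear ?R" "?R (scaleC c z) = scaleC c (?R z)" for c z
      unfolding R[abs_def] by (auto intro!: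
          bounded_linear_Pair[OF bounded_ops_linear bounded_ops_linear]
          simp: scaleC_prod_def bounded_opsD(3)[OF op_ops(1)] bounded_opsD(3)[OF op_ops(2)]
            bounded_opsD(3)[OF ldiag_bounded_ops[OF C_ops]] bounded_opsD(3)[OF
                ldiag_bounded_ops[OF D_ops]]
            scaleC_add_right)
  qed
  have R_Y: "?R z \<in> ?Y" if "z \<in> ?X" for z
  proof -
    have x: "fst z \<in> level n F" and u: "snd z \<in> level n UNIV"
      using that by auto
    show ?thesis
      unfolding R mem_Times_iff fst_conv snd_conv
      by (intro conjI closed_csubspaceD(3)[OF closed_csubspace_level[OF F_closed]]
          closed_csubspaceD(3)[OF closed_csubspace_level[OF closed_csubspace_UNIV]]
          op_in_level(1)[OF x] op_in_level(2)[OF u] ldiag_in_level[OF C_ops x]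
              ldiag_in_level[OF D_ops u])
  qed
  have "?R \<in> bounded_ops ?X ?Y"
    by (rule bounded_ops_restrict[OF R_ops subset_UNIV R_Y])
  moreover have "?R (adjoint_on ?X ?Y ?R y) = y" if "y \<in> ?Y" for y
  proof -
    obtain p e where y: "y = (p, e)" "p \<in> level (Suc n) F" "e \<in> level n UNIV"
      using \<open>y \<in> ?Y\<close> by blast
    \<comment> \<open>The formulas for the adjoint on the ambient spaces remain valid on the
      subspaces because, on \<open>?Y\<close>, they take values in \<open>?X\<close>.\<close>
    have "adjoint_on ?X ?Y ?R y = (dualA p + ldiag (adj C) e, dualB p + ldiag (adj D) e)"
    proof (rule adjoint_on_eqI[OF X that])
      show "(dualA p + ldiag (adj C) e, dualB p + ldiag (adj D) e) \<in> ?X"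
        using dual_in_level[OF y(2,3)] by simp
      show "cinner (?R z) y = cinner z (dualA p + ldiag (adj C) e, dualB p + ldiag (adj D) e)" for z
        by (simp add: R y(1) cinner_prod_def cinner_add_left cinner_add_right cinner_op
            cinner_ldiag C_ops D_ops)
    qed
    then show ?thesis
      using dual_right_inverse[OF y(2), of e] by (simp add: R y(1))
  qed
  ultimately show ?thesis by (simp add: coisometry_on_def)
qed

lemma model_BS_class: "model \<in> BS_class F"
proof -
  have "opA \<in> bounded_ops (level 0 F) (level 1 F)" "opB \<in> bounded_ops (level 0 UNIV) (level 1 F)"
    "ldiag C \<in> bounded_ops (level 0 F) (level 0 UNIV)" "ldiag D
        \<in> bounded_ops (level 0 UNIV) (level 0 UNIV)"
    using op_in_level[where n = 0]
    by (auto intro!: bounded_ops_restrict[OF op_ops(1)] bounded_ops_restrict[OF op_ops(2)]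
        bounded_ops_restrict[OF ldiag_bounded_ops[OF C_ops]]
        bounded_ops_restrict[OF ldiag_bounded_ops[OF D_ops]] ldiag_in_level C_ops D_ops)
  moreover have "opA x = ampl opA x" "ldiag C x = ampl (ldiag C) x" if "1 \<le> n" "x \<in> level n F"
      for n x
    using that op_ampl(1)[of x "n - 1" F 0] ldiag_ampl[OF C_ops, of x "n - 1" F] by (auto
        simp: level_def)
  moreover have "opB u = ampl opB u" "ldiag D u = ampl (ldiag D) u" if "1 \<le> n" "u \<in> level n UNIV"
      for n u
    using that op_ampl(2)[of 0 "n - 1" UNIV u UNIV] ldiag_ampl[OF D_ops, of u "n - 1" UNIV] by (auto
        simp: level_def)
  ultimately show ?thesis
    using model_coisometry unfolding BS_class_def by (simp add: model_def)
qed

section \<open>Trajectories and the transfer map of the model\<close>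

lemma l2_nth_fold_strip: "l2_nth (fold strip w f) v = l2_nth f (w @ v)"
  by (induction w arbitrary: f) auto

lemma state_seq_model:
  "length w = n \<Longrightarrow>
    \<Delta> (l2_nth (state_seq model u n) w) + adj T (fold strip w u) = fold strip w (adj T u)"
proof (induction n arbitrary: w)
  case 0
  then show ?case by (simp add: bounded_ops_zero[OF \<Delta>(1)])
next
  case (Suc n)
  then obtain v j where w: "w = v @ [j]" "length v = n"
    by (cases w rule: rev_cases) auto
  let ?x = "l2_nth (state_seq model u n) v" and ?g = "fold strip v u"
  have "l2_nth (state_seq model u (Suc n)) w = A j ?x + B j (l2_nth ?g [])"
    using w by (simp add: model_def l2_nth_fold_strip)
  then have "\<Delta> (l2_nth (state_seq model u (Suc n)) w) + adj T (fold strip w u)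
      = strip j (\<Delta> ?x) + (strip j (adj T (l2_single [] (l2_nth ?g []))) + adj T (strip j ?g))"
    using w by (simp add: bounded_opsD(2)[OF \<Delta>(1)] \<Delta>_A \<Delta>_B)
  \<comment> \<open>\<open>adj T\<close> commutes with prepending, not with stripping: the value of
    \<open>?g\<close> at the empty word leaves an extra term, which is exactly what
    \<open>B j\<close> feeds into the state.\<close>
  also have "strip j (adj T (l2_single [] (l2_nth ?g []))) + adj T (strip j ?g)
      = strip j (adj T ?g)"
  proof -
    have "strip j (adj T ?g) = strip j (adj T (l2_single [] (l2_nth ?g []))
        + (\<Sum>k\<in>UNIV. prepend k (adj T (strip k ?g))))"
      using adj_T_decompose[of ?g] by simp
    also have "\<dots> = strip j (adj T (l2_single [] (l2_nth ?g [])))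
        + (\<Sum>k\<in>UNIV. strip j (prepend k (adj T (strip k ?g))))"
      by (simp add: bounded_opsD(2)[OF strip_bounded_ops] bounded_ops_sum[OF strip_bounded_ops])
    finally show ?thesis by (simp add: strip_prepend)
  qed
  also have "strip j (\<Delta> ?x) + strip j (adj T ?g) = strip j (\<Delta> ?x + adj T ?g)"
    by (simp add: bounded_opsD(2)[OF strip_bounded_ops])
  finally show ?case
    using Suc.IH[OF w(2)] w by simp
qed

lemma model_transfer_map: "is_transfer_map model (adj T)"
  unfolding is_transfer_map_def
proof (intro allI l2_eqI)
  fix u n w
  have "output_seq model u n \<in> level n UNIV"
    unfolding output_seq_def
    by (intro BS_class_step(2)[OF F_closed model_BS_class]
        state_seq_in_level[OF F_closed model_BS_class]
        proj_level_in_level)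
  moreover have "l2_nth (output_seq model u n) w = l2_nth (adj T u) w" if w: "length w = n"
  proof -
    let ?g = "fold strip w u"
    have "l2_nth (adj T u) w = l2_nth (fold strip w (adj T u)) []"
      by (simp add: l2_nth_fold_strip)
    also have "\<dots> = C (l2_nth (state_seq model u n) w) + l2_nth (adj T ?g) []"
      by (simp add: state_seq_model[OF w, symmetric] C_def)
    \<comment> \<open>All prepended terms vanish at the empty word, so only the current input value
      contributes.\<close>
    also have "l2_nth (adj T ?g) [] = D (l2_nth ?g [])"
      using arg_cong[OF adj_T_decompose[of ?g], of "\<lambda>h. l2_nth h []"] by (simp add: D_def)
    finally show ?thesis
      using w by (simp add: output_seq_def model_def C_ops D_ops l2_nth_fold_strip)
  qed
  ultimately show "l2_nth (proj_level n (adj T u)) w = l2_nth (output_seq model u n) w"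
    by (cases "length w = n") (auto simp: level_def)
qed

end

lemma obtain_functional_model:
  fixes T :: "('n::finite, 'e1::complex_hilbert) fock \<Rightarrow> ('n, 'e2::complex_hilbert) fock"
  assumes T: "T \<in> schur_class"
  obtains \<Delta> A B where "functional_model T \<Delta> A B"
proof -
  have ops: "T \<in> bounded_ops UNIV UNIV" and contr: "\<And>f. norm (T f) \<le> norm f"
    using T by (auto simp: schur_class_def)
  have adj_contr: "norm (adj T u) \<le> norm u" for u
    using norm_le_if_adjoint_pair[of T "adj T" 1 u] contr by (simp add: cinner_adj[OF ops])
  have "(\<lambda>f. adj T (T f)) \<in> bounded_ops UNIV UNIV"
    by (intro bounded_ops_compose[OF adj_bounded_ops] ops)
  moreover have "norm (adj T (T f)) \<le> norm f" for f
    using adj_contr contr by (rule order_trans)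
  moreover have "cinner (adj T (T f)) g = cinner f (adj T (T g))" for f g
    by (simp add: cinner_adj[OF ops] cinner_adj'[OF ops])
  ultimately obtain \<Delta> where \<Delta>: "\<Delta> \<in> bounded_ops UNIV UNIV" "\<And>f g. cinner (\<Delta> f) g = cinner f (\<Delta> g)"
      "\<And>f. \<Delta> (\<Delta> f) = f - adj T (T f)"
    using obtain_sqrt_defect[of "\<lambda>f. adj T (T f)"] by metis
  have norm_\<Delta>: "(norm (\<Delta> f))\<^sup>2 = (norm f)\<^sup>2 - (norm (T f))\<^sup>2" for f
  proof -
    have "cinner (\<Delta> f) (\<Delta> f) = cinner f f - cinner (T f) (T f)"
      by (simp add: \<Delta>(2,3) cinner_diff_right cinner_adj[OF ops])
    then show ?thesis
      by (simp add: power2_norm_eq_inner inner_eq_Re_cinner)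
  qed
  \<comment> \<open>Stripping \<open>j\<close> from \<open>T (prepend j f)\<close> gives
    \<open>T f\<close>, so \<open>norm_strip_le\<close> bounds the sum of their squared norms;
    subtracting from the squared norm of \<open>f\<close> gives the claim.\<close>
  have bound: "(norm (\<Delta> (prepend j f)))\<^sup>2 + (norm (l2_nth (T (prepend j f)) []))\<^sup>2 \<le> (norm (\<Delta> f))\<^sup>2"
      for j f
    using norm_strip_le[of "T (prepend j f)" j]
    by (simp add: norm_\<Delta> norm_prepend schur_class_strip(2)[OF T] strip_prepend)
  have "\<exists>A \<in> bounded_ops UNIV UNIV. (\<forall>x. A x \<in> closure (range \<Delta>)) \<and> (\<forall>f. adj A (\<Delta> f)
      = \<Delta> (prepend j f))" for j
  proof (rule douglas[OF \<Delta>(1) bounded_ops_compose[OF \<Delta>(1) prepend_bounded_ops[of j]]])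
    show "norm (\<Delta> (prepend j f)) \<le> norm (\<Delta> f)" for f
      by (rule power2_le_imp_le[OF order_trans[OF _ bound[of j f]]]) simp_all
  qed blast
  then obtain A where A: "\<And>j. A j \<in> bounded_ops UNIV UNIV" "\<And>j x. A j x \<in> closure (range \<Delta>)"
      "\<And>j f. adj (A j) (\<Delta> f) = \<Delta> (prepend j f)"
    by metis
  have "\<exists>B \<in> bounded_ops UNIV UNIV. (\<forall>u. B u \<in> closure (range \<Delta>)) \<and>
      (\<forall>f. adj B (\<Delta> f) = l2_nth (T (prepend j f)) [])" for j
  proof (rule douglas[OF \<Delta>(1) bounded_ops_compose[OF l2_nth_bounded_ops
          bounded_ops_compose[OF ops prepend_bounded_ops[of j]]]])
    show "norm (l2_nth (T (prepend j f)) []) \<le> norm (\<Delta> f)" for f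
      by (rule power2_le_imp_le[OF order_trans[OF _ bound[of j f]]]) simp_all
  qed blast
  then obtain B where B: "\<And>j. B j \<in> bounded_ops UNIV UNIV" "\<And>j u. B j u \<in> closure (range \<Delta>)"
      "\<And>j f. adj (B j) (\<Delta> f) = l2_nth (T (prepend j f)) []"
    by metis
  show ?thesis
    by (rule that[of \<Delta> A B], unfold_locales) (fact T \<Delta> A B)+
qed

text \<open>A state space ranges over subspaces of a type, and types cannot be quantified. The
  equivalence therefore fixes the type \<open>('n, 'e1) fock\<close>, large enough for the model,
  and the last conjunct gives sufficiency for state spaces in an arbitrary type
  \<open>'f\<close>.\<close>

theorem theorem3p4:
  fixes T :: "('n::finite, 'e1::complex_hilbert) fock \<Rightarrow> ('n, 'e2::complex_hilbert) fock"
  assumes "T \<in> bounded_ops UNIV UNIV"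
  shows "(T \<in> schur_class \<longleftrightarrow>
            (\<exists>(F :: ('n, 'e1) fock set) (\<Sigma> :: ('n, 'e1, 'e2, ('n, 'e1) fock) system).
               closed_csubspace F \<and> \<Sigma> \<in> BS_class F \<and>
               is_transfer_map \<Sigma> (adjoint_on UNIV UNIV T)))
       \<and> (\<forall>(F :: 'f::complex_hilbert set) (\<Sigma> :: ('n, 'e1, 'e2, 'f) system).
            closed_csubspace F \<and> \<Sigma> \<in> BS_class F \<and>
            is_transfer_map \<Sigma> (adjoint_on UNIV UNIV T) \<longrightarrow> T \<in> schur_class)"
proof (intro conjI iffI)
  assume "T \<in> schur_class"
  then obtain \<Delta> A B where "functional_model T \<Delta> A B"
    by (rule obtain_functional_model)
  then interpret functional_model T \<Delta> A B .
  show "\<exists>(F :: ('n, 'e1) fock set) (\<Sigma> :: ('n, 'e1, 'e2, ('n, 'e1) fock) system).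
      closed_csubspace F \<and> \<Sigma> \<in> BS_class F \<and> is_transfer_map \<Sigma> (adj T)"
    using F_closed model_BS_class model_transfer_map by blast
qed (use schur_class_if_transfer_map[OF assms] in blast)+

end
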